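(* Let $U\subseteq\mathbb{R}^m$ be a bounded open Lipschitz domain. If $A_n\to A$ in $C^{0,1}(\overline U,\mathrm{Norm}(d))$, then $\mathcal{E}_u(A_n)\to\mathcal{E}_u(A)$ in $C^{0,\alpha}(\overline U,\mathcal{A}_d(\mathbb{C}))$ as $n\to\infty$, for all $0<\alpha<1$, but not for $\alpha=1$, in the sense that $$\|\Delta\circ\mathcal{E}_u(A)-\Delta\circ\mathcal{E}_u(A_n)\|_{C^{0,\alpha}(\overline U,\mathbb{R}^N)}\to0\quad\text{as }n\to\infty,$$ for each Almgren embedding $\Delta:\mathcal{A}_d(\mathbb{C})\to\mathbb{R}^N$.
   Context: $M_d(\mathbb{C})$ is the space of complex $d\times d$ matrices with the Frobenius norm $\|A\|_2=(\sum_{i,j}|a_{ij}|^2)^{1/2}$, and $\mathrm{Norm}(d)=\{A\in M_d(\mathbb{C}):A^*A=AA^*\}$ is the set of normal matrices. $\mathcal{A}_d(\mathbb{C})$ is the set of unordered $d$-tuples $[z]=[z_1,\dots,z_d]$ of complex numbers with the metric $\mathbf{d}_2([z],[w])=\min_{\sigma\in S_d}(\sum_{i=1}^d|z_i-w_{\sigma(i)}|^2)^{1/2}$, where $S_d$ is the symmetric group. For a family $A$ of normal matrices on $U$, $\mathcal{E}_u(A):U\to\mathcal{A}_d(\mathbb{C})$ is the map whose value at $x$ is the unordered tuple of the eigenvalues of $A(x)$ with multiplicity. Almgren embedding: for a unit complex number $\theta$ put $\eta(z)=\mathrm{Re}(\theta z)$ and let $H:\mathcal{A}_d(\mathbb{C})\to\mathbb{R}^d$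 send $[z]$ to the array of the numbers $\eta(z_1),\dots,\eta(z_d)$ arranged in increasing order. Choose a finite set $\{\eta_1,\dots,\eta_h\}$ of such forms (given by unit complex numbers $\theta_1,\dots,\theta_h$) for which there is $c>0$ such that for any $d^2$ complex numbers $z_1,\dots,z_{d^2}$ some $\eta_l$ satisfies $|\eta_l(z_k)|\ge c|z_k|$ for all $k$ (such sets exist). With $H_l$ the map associated to $\eta_l$, $\Delta([z])=h^{-1/2}(H_1([z]),\dots,H_h([z]))\in\mathbb{R}^N$, $N=dh$, is an Almgren embedding; it is bi-Lipschitz onto its image with $\mathrm{Lip}(\Delta)\le1$. For $\alpha\in(0,1]$ and a finite-dimensional real normed space $V$ with norm $\|\cdot\|_2$ (Euclidean on $\mathbb{R}^N$, Frobenius on $M_d(\mathbb{C})$), $C^{0,\alpha}(\overline U,V)$ is the space of continuous maps $f:U\to V$ that extend continuously to $\overline U$ with finite norm $\sup_{x\in U}\|f(x)\|_2+\sup_{x\ne y\in U}\frac{\|f(x)-f(y)\|_2}{\|x-y\|_2^\alpha}$. A map $f$ belongs to $C^{0,\alpha}(\overline U,\mathcal{A}_d(\mathbb{C}))$ if and only if $\Delta\circ f\in C^{0,\alpha}(\overline U,\mathbb{R}^N)$. $C^{0,1}(\overline U,\mathrm{Norm}(d))$ is the set of $A\in C^{0,1}(\overline U,M_d(\mathbb{C}))$ with values in $\mathrm{Norm}(d)$, with the induced topology. A Lipschitz domain is an open set with Lipschitz boundary. *)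

theory Defs
  imports
    "HOL-Analysis.Analysis"
    "HOL-Computational_Algebra.Polynomial"
    "HOL-Library.Multiset"
    "HOL-Library.More_List"
begin

section \<open>Normal matrices and their unordered eigenvalues\<close>

definition adjoint_matrix :: "complex^'d^'d \<Rightarrow> complex^'d^'d" where
  "adjoint_matrix A = map_matrix cnj (transpose A)"

definition normal_matrices :: "(complex^'d^'d) set" where
  "normal_matrices = {A. adjoint_matrix A ** A = A ** adjoint_matrix A}"

definition char_polynomial :: "complex^'d^'d \<Rightarrow> complex poly" where
  "char_polynomial A = det (\<chi> i j. (if i = j then [:0, 1:] else 0) - [:A $ i $ j:])"

text \<open>
  An unordered \<open>d\<close>-tuple of complex numbers is a multiset of size \<open>d\<close>.
\<close>

definition unordered_tuples :: "nat \<Rightarrow> complex multiset set" where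
  "unordered_tuples d = {M. size M = d}"

definition unordered_eigenvalues :: "('a \<Rightarrow> complex^'d^'d) \<Rightarrow> 'a \<Rightarrow> complex multiset" where
  "unordered_eigenvalues A x = proots (char_polynomial (A x))"


section \<open>Almgren embeddings\<close>

text \<open>
  A point of \<open>\<real>\<^sup>N\<close>, for a dimension \<open>N\<close> that is not a type, is a function \<open>v :: nat \<Rightarrow> real\<close>
  with \<open>v k = 0\<close> for all \<open>k \<ge> N\<close>.  On such functions the topology of the type
  \<open>nat \<Rightarrow> real\<close> (the product topology) is the Euclidean one.
\<close>

definition euclidean_norm :: "nat \<Rightarrow> (nat \<Rightarrow> real) \<Rightarrow> real" where
  "euclidean_norm N v = L2_set v {..<N}"

definition real_form :: "complex \<Rightarrow> complex \<Rightarrow> real" where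
  "real_form \<theta> z = Re (\<theta> * z)"

text \<open>The finite set of forms is given as a list, which fixes the order of the blocks of
  the embedding.\<close>

definition almgren_forms :: "nat \<Rightarrow> complex list \<Rightarrow> bool" where
  "almgren_forms d \<theta>s \<longleftrightarrow> distinct \<theta>s \<and> (\<forall>\<theta>\<in>set \<theta>s. cmod \<theta> = 1) \<and>
     (\<exists>c>0. \<forall>z :: nat \<Rightarrow> complex. \<exists>\<theta>\<in>set \<theta>s. \<forall>k<d\<^sup>2. \<bar>real_form \<theta> (z k)\<bar> \<ge> c * cmod (z k))"

definition sorted_values :: "complex \<Rightarrow> complex multiset \<Rightarrow> real list" where
  "sorted_values \<theta> M = sorted_list_of_multiset (image_mset (real_form \<theta>) M)"

definition almgren_map :: "complex list \<Rightarrow> complex multiset \<Rightarrow> nat \<Rightarrow> real" where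
  "almgren_map \<theta>s M =
     nth_default 0 (map (\<lambda>t. t / sqrt (real (length \<theta>s)))
       (concat (map (\<lambda>\<theta>. sorted_values \<theta> M) \<theta>s)))"

definition almgren_embedding :: "nat \<Rightarrow> nat \<Rightarrow> (complex multiset \<Rightarrow> nat \<Rightarrow> real) \<Rightarrow> bool" where
  "almgren_embedding d N \<Delta> \<longleftrightarrow>
     (\<exists>\<theta>s. almgren_forms d \<theta>s \<and> N = d * length \<theta>s \<and>
        (\<forall>M\<in>unordered_tuples d. \<Delta> M = almgren_map \<theta>s M))"


section \<open>Hoelder spaces\<close>

text \<open>
  The norm \<open>nrm\<close> of the target space is a parameter, so that the same definitions serve for
  matrices and for \<open>\<real>\<^sup>N\<close>.  Only the values of a map on \<open>U\<close> matter.
\<close>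

definition holder_norm ::
  "('v \<Rightarrow> real) \<Rightarrow> (real^'m) set \<Rightarrow> real \<Rightarrow> (real^'m \<Rightarrow> 'v::minus) \<Rightarrow> ennreal" where
  "holder_norm nrm U \<alpha> f =
     (SUP x\<in>U. ennreal (nrm (f x))) +
     (SUP (x, y)\<in>{(x, y). x \<in> U \<and> y \<in> U \<and> x \<noteq> y}.
        ennreal (nrm (f x - f y) / norm (x - y) powr \<alpha>))"

definition holder_space ::
  "('v \<Rightarrow> real) \<Rightarrow> (real^'m) set \<Rightarrow> real \<Rightarrow> (real^'m \<Rightarrow> 'v::{minus,topological_space}) set" where
  "holder_space nrm U \<alpha> =
     {f. (\<exists>g. continuous_on (closure U) g \<and> (\<forall>x\<in>U. g x = f x)) \<and> holder_norm nrm U \<alpha> f < \<infinity>}"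

text \<open>The library norm on \<open>complex^'d^'d\<close> is the Frobenius norm.\<close>

definition lipschitz_normal :: "(real^'m) set \<Rightarrow> (real^'m \<Rightarrow> complex^'d^'d) set" where
  "lipschitz_normal U = {A \<in> holder_space norm U 1. \<forall>x\<in>U. A x \<in> normal_matrices}"

definition tendsto_lipschitz_normal ::
  "(real^'m) set \<Rightarrow> (nat \<Rightarrow> real^'m \<Rightarrow> complex^'d^'d) \<Rightarrow> (real^'m \<Rightarrow> complex^'d^'d) \<Rightarrow> bool" where
  "tendsto_lipschitz_normal U An A \<longleftrightarrow>
     (\<forall>n. An n \<in> lipschitz_normal U) \<and> A \<in> lipschitz_normal U \<and>
     (\<lambda>n. holder_norm norm U 1 (\<lambda>x. A x - An n x)) \<longlonglongrightarrow> 0"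

definition holder_unordered ::
  "nat \<Rightarrow> (real^'m) set \<Rightarrow> real \<Rightarrow> (real^'m \<Rightarrow> complex multiset) set" where
  "holder_unordered d U \<alpha> =
     {f. (\<forall>x\<in>U. f x \<in> unordered_tuples d) \<and>
         (\<forall>N \<Delta>. almgren_embedding d N \<Delta> \<longrightarrow> \<Delta> \<circ> f \<in> holder_space (euclidean_norm N) U \<alpha>)}"


section \<open>Lipschitz domains\<close>

text \<open>
  Near every boundary point, \<open>U\<close> is the strict epigraph of a Lipschitz function in suitable
  Euclidean coordinates: \<open>\<nu>\<close> is the direction of the last coordinate axis, and the hyperplane
  orthogonal to \<open>\<nu>\<close> carries the other coordinates.
\<close>

definition lipschitz_domain :: "(real^'m) set \<Rightarrow> bool" where
  "lipschitz_domain U \<longleftrightarrow> open U \<and>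
     (\<forall>p\<in>frontier U. \<exists>r>0. \<exists>\<nu>. norm \<nu> = 1 \<and>
        (\<exists>L \<gamma>. L-lipschitz_on {y. y \<bullet> \<nu> = 0} \<gamma> \<and>
           U \<inter> ball p r = {x \<in> ball p r. x \<bullet> \<nu> > (\<gamma> (x - (x \<bullet> \<nu>) *\<^sub>R \<nu>) :: real)}))"

end

theory Submission
  imports Defs "HOL-Computational_Algebra.Fundamental_Theorem_Algebra"
begin

text \<open>
  The real part of \<open>\<theta> A\<close>, for \<open>A\<close> normal, is Hermitian with eigenvalues \<open>Re (\<theta> \<lambda>\<^sub>i)\<close>, so by
  Weyl's inequality each sorted value \<open>Re (\<theta> \<lambda>\<^sub>i)\<close>, hence each coordinate of the Almgren embedding
  of the spectrum, is a Lipschitz function of \<open>A\<close>.  Convergence in \<open>C\<^sup>0\<^sup>,\<^sup>1\<close> therefore gives uniform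
  convergence of the embedded spectra with bounded Lipschitz constants, and interpolating between the two
  bounds gives convergence of the Hoelder norms for every exponent below 1.
  For exponent 1 it fails for \<open>A = diag(s, 0, \<dots>, 0)\<close> and \<open>A\<^sub>n = diag(s + t\<^sub>n, 0, \<dots>, 0)\<close>, where \<open>s\<close> is an
  affine function vanishing inside \<open>U\<close> and \<open>t\<^sub>n > 0\<close> tends to 0: the smallest sorted real part is
  \<open>min s 0\<close> or \<open>min (s + t\<^sub>n) 0\<close>, and the difference of these two has slope 1 on \<open>-t\<^sub>n < s < 0\<close>.
\<close>

section \<open>The spectral theorem for normal matrices\<close>

lemma vec_dim_le_card: "vec.dim (S :: ('a::field^'d) set) \<le> CARD('d)"
  unfolding vec_dim_card[where 'a = 'a, symmetric] by (rule vec.dim_subset) simp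

section \<open>Hermitian inner product and adjoints\<close>

definition cinner :: "complex^'d \<Rightarrow> complex^'d \<Rightarrow> complex" where
  "cinner x y = (\<Sum>i\<in>UNIV. x $ i * cnj (y $ i))"

lemma cinner_add_left: "cinner (x + y) z = cinner x z + cinner y z"
  by (simp add: cinner_def algebra_simps sum.distrib)

lemma cinner_diff_left: "cinner (x - y) z = cinner x z - cinner y z"
  by (simp add: cinner_def algebra_simps sum_subtractf)

lemma cinner_diff_right: "cinner x (y - z) = cinner x y - cinner x z"
  by (simp add: cinner_def algebra_simps sum_subtractf)

lemma cinner_scale_left: "cinner (c *s x) y = c * cinner x y"
  by (simp add: cinner_def sum_distrib_left algebra_simps)

lemma cinner_scale_right: "cinner x (c *s y) = cnj c * cinner x y"
  by (simp add: cinner_def sum_distrib_left algebra_simps)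

lemma cinner_sum_left: "cinner (\<Sum>i\<in>I. f i) y = (\<Sum>i\<in>I. cinner (f i) y)"
  by (induction I rule: infinite_finite_induct) (simp_all add: cinner_add_left, simp_all add: cinner_def)

lemma cinner_commute: "cinner y x = cnj (cinner x y)"
  by (simp add: cinner_def mult.commute)

lemma cinner_sum_right: "cinner x (\<Sum>i\<in>I. f i) = (\<Sum>i\<in>I. cinner x (f i))"
  by (subst cinner_commute) (simp add: cinner_sum_left cnj_sum flip: cinner_commute)

lemma Re_cinner: "Re (cinner x y) = x \<bullet> y"
  by (simp add: cinner_def inner_vec_def inner_complex_def)

lemma cinner_self: "cinner x x = of_real ((norm x)\<^sup>2)"
  by (rule complex_eqI)
    (simp_all add: Re_cinner power2_norm_eq_inner, simp add: cinner_def mult.commute)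

lemma cinner_self_eq_0: "cinner x x = 0 \<longleftrightarrow> x = 0"
  by (simp add: cinner_self)

lemma cinner_matrix_left: "cinner (A *v x) y = cinner x (adjoint_matrix A *v y)"
proof -
  have "cinner (A *v x) y = (\<Sum>i\<in>UNIV. \<Sum>j\<in>UNIV. A $ i $ j * x $ j * cnj (y $ i))"
    by (simp add: cinner_def matrix_vector_mult_def sum_distrib_right)
  also have "\<dots> = (\<Sum>j\<in>UNIV. \<Sum>i\<in>UNIV. A $ i $ j * x $ j * cnj (y $ i))"
    by (rule sum.swap)
  also have "\<dots> = cinner x (adjoint_matrix A *v y)"
    by (simp add: cinner_def matrix_vector_mult_def adjoint_matrix_def map_matrix_def
        transpose_def sum_distrib_left cnj_sum mult_ac)
  finally show ?thesis .
qed

text \<open>Expand the squared norm of \<open>?B *v v - cnj l *s v\<close>. Commuting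
  \<open>A\<close> past its adjoint turns the squared norm of \<open>?B *v v\<close> into
  \<open>l * cinner (?B *v v) v\<close>, after which the four terms cancel.\<close>

lemma normal_eigenvector_adjoint:
  assumes "A \<in> normal_matrices" "A *v v = l *s v"
  shows "adjoint_matrix A *v v = cnj l *s v"
proof -
  let ?B = "adjoint_matrix A"
  have comm: "A *v (?B *v v) = ?B *v (A *v v)"
    using assms(1) by (simp add: normal_matrices_def matrix_vector_mul_assoc)
  have 1: "cinner (?B *v v) (?B *v v) = l * cinner (?B *v v) v"
    by (simp add: comm assms(2) vec.scale cinner_scale_left flip: cinner_matrix_left)
  have 2: "cinner v (?B *v v) = l * cinner v v"
    by (simp add: assms(2) cinner_scale_left flip: cinner_matrix_left)
  have "cinner (?B *v v - cnj l *s v) (?B *v v - cnj l *s v) = 0"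
    by (simp add: cinner_diff_left cinner_diff_right cinner_scale_left cinner_scale_right 1 2
        algebra_simps)
  then show ?thesis by (simp add: cinner_self_eq_0)
qed

text \<open>Here \<open>p(A)\<close> annihilates \<open>w\<close>. Split off a root,
  \<open>p = (X - z) q\<close>, and put \<open>u = q(A) w\<close>, which stays in \<open>W\<close>.
  Either \<open>u\<close> is an eigenvector for \<open>z\<close>, or \<open>q(A)\<close> annihilates
  \<open>w\<close> as well and the induction continues. The bound \<open>n\<close> is kept apart
  from the degree so that the sums have a fixed range.\<close>

lemma subspace_eigenvector_of_annihilating_poly:
  fixes A :: "complex^'d^'d"
  assumes W: "vec.subspace W" and AW: "\<And>v. v \<in> W \<Longrightarrow> A *v v \<in> W"
  shows "p \<noteq> 0 \<Longrightarrow> degree p \<le> n \<Longrightarrow> w \<in> W \<Longrightarrow> w \<noteq> 0 \<Longrightarrow>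
    (\<Sum>i<Suc n. coeff p i *s (((*v) A) ^^ i) w) = 0 \<Longrightarrow> \<exists>v l. v \<in> W \<and> v \<noteq> 0 \<and> A *v v = l *s v"
proof (induction n arbitrary: p)
  case 0
  then have "coeff p 0 \<noteq> 0" by (metis le_zero_eq leading_coeff_0_iff)
  with 0 show ?case by simp
next
  case (Suc n)
  show ?case
  proof (cases "degree p = 0")
    \<comment> \<open>A nonzero constant has no root to split off. Its coefficient at
      \<open>Suc n\<close> is 0, so the bound alone is lowered.\<close>
    case True
    then have "(\<Sum>i<Suc n. coeff p i *s (((*v) A) ^^ i) w) = 0"
      using Suc.prems(5) by (simp add: coeff_eq_0)
    then show ?thesis using Suc.IH[of p] Suc.prems True by simp
  next
    case False
    then have "\<not> constant (poly p)" by (simp add: constant_degree)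
    then obtain z where "poly p z = 0" using fundamental_theorem_of_algebra by blast
    then obtain q where q: "p = [:-z, 1:] * q" by (metis dvdE poly_eq_0_iff_dvd)
    have q0: "q \<noteq> 0" using q Suc.prems(1) by auto
    have degq: "degree q \<le> n"
      using Suc.prems(2) q q0 degree_mult_eq[of "[:-z, 1:]" q] by simp
    \<comment> \<open>Multiplication by \<open>X - z\<close> is written as a shift minus a scaling:
      the shifted sum is \<open>A *v u\<close>, the scaled one \<open>z *s u\<close>.\<close>
    have pq: "p = pCons 0 q - smult z q" using q by simp
    define u where "u = (\<Sum>i<Suc n. coeff q i *s (((*v) A) ^^ i) w)"
    have iter: "(((*v) A) ^^ i) w \<in> W" for i
      by (induction i) (auto simp: Suc.prems AW)
    have uW: "u \<in> W"
      unfolding u_def by (intro vec.subspace_sum[OF W] vec.subspace_scale[OF W] iter)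
    have "(\<Sum>i<Suc (Suc n). coeff (pCons 0 q) i *s (((*v) A) ^^ i) w)
        = (\<Sum>i<Suc n. coeff q i *s (((*v) A) ^^ Suc i) w)"
      by (subst sum.lessThan_Suc_shift) (simp del: sum.lessThan_Suc)
    also have "\<dots> = A *v u"
      by (simp add: u_def vec.sum vec.scale del: sum.lessThan_Suc)
    finally have 1: "(\<Sum>i<Suc (Suc n). coeff (pCons 0 q) i *s (((*v) A) ^^ i) w) = A *v u" .
    have "(\<Sum>i<Suc (Suc n). coeff (smult z q) i *s (((*v) A) ^^ i) w)
        = (\<Sum>i<Suc n. coeff (smult z q) i *s (((*v) A) ^^ i) w)"
      using degq by (simp add: coeff_eq_0)
    also have "\<dots> = z *s u"
      by (simp add: u_def vec.scale_sum_right del: sum.lessThan_Suc)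
    finally have 2: "(\<Sum>i<Suc (Suc n). coeff (smult z q) i *s (((*v) A) ^^ i) w) = z *s u" .
    have "A *v u - z *s u = 0"
      using Suc.prems(5) unfolding pq
      by (simp add: vec.scale_left_diff_distrib sum_subtractf 1 2 del: sum.lessThan_Suc coeff_pCons_Suc coeff_smult)
    then have Au: "A *v u = z *s u" by simp
    show ?thesis
    proof (cases "u = 0")
      case True
      then show ?thesis using Suc.IH[OF q0 degq] Suc.prems unfolding u_def by blast
    next
      case False
      then show ?thesis using uW Au by blast
    qed
  qed
qed

text \<open>The \<open>CARD('d) + 1\<close> Krylov iterates \<open>w\<close>, \<open>A w\<close>,
  \<open>A (A w)\<close>, ... are linearly dependent, and a dependence between them is a polynomial
  in \<open>A\<close> annihilating \<open>w\<close>.\<close>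

lemma invariant_subspace_eigenvector:
  fixes A :: "complex^'d^'d"
  assumes W: "vec.subspace W" and AW: "\<And>v. v \<in> W \<Longrightarrow> A *v v \<in> W" and w: "w \<in> W" "w \<noteq> 0"
  shows "\<exists>v l. v \<in> W \<and> v \<noteq> 0 \<and> A *v v = l *s v"
proof -
  let ?n = "CARD('d)"
  let ?g = "\<lambda>i. (((*v) A) ^^ i) w"
  \<comment> \<open>Linear dependence is a notion for sets, so repeated iterates are treated apart:
    if iterates \<open>i\<close> and \<open>j\<close> coincide, the polynomial is
    \<open>X^i - X^j\<close>.\<close>
  have "\<exists>p. p \<noteq> 0 \<and> degree p \<le> ?n \<and> (\<Sum>i<Suc ?n. coeff p i *s ?g i) = 0"
  proof (cases "inj_on ?g {..<Suc ?n}")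
    case True
    have "vec.dim (?g ` {..<Suc ?n}) \<le> ?n"
      by (rule vec_dim_le_card)
    then have "vec.dependent (?g ` {..<Suc ?n})"
      by (intro vec.dependent_biggerset_general) (simp add: card_image[OF True])
    then obtain u where u: "\<exists>v\<in>?g ` {..<Suc ?n}. u v \<noteq> 0"
      and s: "(\<Sum>v\<in>?g ` {..<Suc ?n}. u v *s v) = 0"
      by (subst (asm) vec.dependent_finite) auto
    obtain k where k: "k < Suc ?n" "u (?g k) \<noteq> 0" using u by auto
    define p where "p = (\<Sum>i<Suc ?n. monom (u (?g i)) i)"
    have cp: "coeff p i = (if i < Suc ?n then u (?g i) else 0)" for i
      by (simp add: p_def coeff_sum if_distrib sum.delta' del: sum.lessThan_Suc cong: if_cong)
    have "p \<noteq> 0" using k cp by (metis coeff_0)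
    moreover have "degree p \<le> ?n" by (rule degree_le) (simp add: cp)
    moreover have "(\<Sum>i<Suc ?n. coeff p i *s ?g i) = 0"
      using s by (simp add: sum.reindex[OF True] cp o_def del: sum.lessThan_Suc)
    ultimately show ?thesis by blast
  next
    case False
    then obtain i j where ij: "i < Suc ?n" "j < Suc ?n" "i \<noteq> j" "?g i = ?g j"
      by (auto simp: inj_on_def)
    define p :: "complex poly" where "p = monom 1 i - monom 1 j"
    have cp: "coeff p k = (if k = i then 1 else 0) - (if k = j then 1 else 0)" for k
      by (simp add: p_def)
    have "p \<noteq> 0" using ij cp[of i] by auto
    moreover have "degree p \<le> ?n" by (rule degree_le) (use ij in \<open>auto simp: cp\<close>)
    moreover have "(\<Sum>k<Suc ?n. coeff p k *s ?g k) =
        (\<Sum>k<Suc ?n. if k = i then ?g k else 0) - (\<Sum>k<Suc ?n. if k = j then ?g k else 0)"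
      unfolding sum_subtractf[symmetric] by (rule sum.cong) (auto simp: cp)
    then have "(\<Sum>k<Suc ?n. coeff p k *s ?g k) = 0"
      using ij by (simp add: sum.delta del: sum.lessThan_Suc)
    ultimately show ?thesis by blast
  qed
  then show ?thesis
    using subspace_eigenvector_of_annihilating_poly[OF W AW] w by blast
qed

section \<open>Orthonormal eigenbases\<close>

definition orthonormal_family :: "('i \<Rightarrow> complex^'d) \<Rightarrow> bool" where
  "orthonormal_family f \<longleftrightarrow> (\<forall>i j. cinner (f i) (f j) = (if i = j then 1 else 0))"

lemma orthonormal_set_independent:
  fixes S :: "(complex^'d) set"
  assumes "\<forall>x\<in>S. \<forall>y\<in>S. cinner x y = (if x = y then 1 else 0)"
  shows "vec.independent S"
  unfolding vec.independent_explicit_finite_subsets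
proof (intro allI impI ballI)
  fix T u v assume T: "T \<subseteq> S" "finite T" and s: "(\<Sum>v\<in>T. u v *s v) = 0" and v: "v \<in> T"
  have "0 = cinner (\<Sum>v\<in>T. u v *s v) v" by (simp add: s cinner_def)
  also have "\<dots> = (\<Sum>x\<in>T. u x * (if x = v then 1 else 0))"
    unfolding cinner_sum_left cinner_scale_left
    using assms T v by (intro sum.cong refl) (auto simp: subset_iff)
  also have "\<dots> = (\<Sum>x\<in>T. if x = v then u x else 0)" by (intro sum.cong) auto
  also have "\<dots> = u v" using T v by simp
  finally show "u v = 0" by simp
qed

text \<open>Take an orthonormal set of eigenvectors of greatest size. Its members are eigenvectors
  of the adjoint too, so its orthogonal complement is invariant under \<open>A\<close>. A nonzero
  complement would contain one more eigenvector, against maximality.\<close>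

theorem normal_matrix_eigenbasis:
  fixes A :: "complex^'d^'d"
  assumes "A \<in> normal_matrices"
  shows "\<exists>(f :: 'd \<Rightarrow> complex^'d) l. orthonormal_family f \<and> (\<forall>i. A *v f i = l i *s f i)"
proof -
  define P where "P S \<longleftrightarrow> (\<forall>x\<in>S. \<forall>y\<in>S. cinner x y = (if x = y then 1 else 0)) \<and>
    (\<forall>x\<in>S. \<exists>l. A *v x = l *s x)" for S
  have fin: "finite S \<and> card S \<le> CARD('d)" if "P S" for S
  proof -
    have ind: "vec.independent S" using that orthonormal_set_independent unfolding P_def by blast
    have "vec.dim S \<le> CARD('d)"
      by (rule vec_dim_le_card)
    then show ?thesis using vec.independent_bound_general[OF ind] by simp
  qed
  have "P {}" by (simp add: P_def)
  then have "\<exists>S. P S \<and> (\<forall>T. P T \<longrightarrow> card T \<le> card S)"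
    using ex_has_greatest_nat[of P "{}" card "Suc CARD('d)"] fin by (meson le_imp_less_Suc)
  then obtain S where S: "P S" and max: "\<And>T. P T \<Longrightarrow> card T \<le> card S" by blast
  have finS: "finite S" using fin[OF S] by simp
  have orth: "cinner x y = (if x = y then 1 else 0)" if "x \<in> S" "y \<in> S" for x y
    using S that by (auto simp: P_def)
  have card: "card S = CARD('d)"
  proof (rule ccontr)
    assume "card S \<noteq> CARD('d)"
    then have less: "card S < CARD('d)" using fin[OF S] by simp
    have "vec.span S \<noteq> UNIV"
    proof
      assume "vec.span S = UNIV"
      then have "CARD('d) \<le> card S"
        using vec.dim_le_card[of UNIV S] finS by (simp add: vec_dim_card flip: vec.dim_UNIV)
      then show False using less by simp
    qed
    then obtain x where x: "x \<notin> vec.span S" by blast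
    \<comment> \<open>The residual of \<open>x\<close> after projection to the span of
      \<open>S\<close>; it is a nonzero vector of the orthogonal complement.\<close>
    define w where "w = x - (\<Sum>s\<in>S. cinner x s *s s)"
    have "(\<Sum>s\<in>S. cinner x s *s s) \<in> vec.span S"
      by (intro vec.span_sum vec.span_scale vec.span_base)
    then have w0: "w \<noteq> 0" using x unfolding w_def by auto
    define W where "W = {v. \<forall>s\<in>S. cinner v s = 0}"
    have W: "vec.subspace W"
      by (auto simp: W_def vec.subspace_def cinner_add_left cinner_scale_left) (simp add: cinner_def)
    have "w \<in> W"
      unfolding W_def
    proof safe
      fix s assume s: "s \<in> S"
      have "(\<Sum>t\<in>S. cinner x t * cinner t s) = (\<Sum>t\<in>S. if t = s then cinner x t else 0)"
        using orth s by (intro sum.cong) auto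
      then show "cinner w s = 0"
        using s finS by (simp add: w_def cinner_diff_left cinner_sum_left cinner_scale_left)
    qed
    moreover have "A *v v \<in> W" if "v \<in> W" for v
      unfolding W_def
    proof safe
      fix s assume s: "s \<in> S"
      obtain l where "A *v s = l *s s" using S s unfolding P_def by blast
      then have "adjoint_matrix A *v s = cnj l *s s"
        by (rule normal_eigenvector_adjoint[OF assms])
      then show "cinner (A *v v) s = 0"
        using that s by (simp add: cinner_matrix_left cinner_scale_right W_def)
    qed
    ultimately obtain v l where v: "v \<in> W" "v \<noteq> 0" "A *v v = l *s v"
      using invariant_subspace_eigenvector[OF W] w0 by blast
    define e where "e = complex_of_real (inverse (norm v)) *s v"
    have ee: "cinner e e = 1"
      using v(2) unfolding e_def cinner_scale_left cinner_scale_right cinner_self[of v]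
      by (simp add: power2_eq_square field_simps)
    have es: "cinner e s = 0" "cinner s e = 0" if "s \<in> S" for s
      using v(1) that by (auto simp: e_def cinner_scale_left W_def cinner_scale_right cinner_commute[of s v])
    have "A *v e = l *s e" by (simp add: e_def vec.scale v(3) vector_smult_assoc mult.commute)
    moreover have enS: "e \<notin> S" using es ee by auto
    ultimately have "P (insert e S)"
      using S ee es unfolding P_def by auto
    then have "card (insert e S) \<le> card S" by (rule max)
    then show False using enS finS by simp
  qed
  obtain f :: "'d \<Rightarrow> complex^'d" where f: "bij_betw f UNIV S"
    using finite_same_card_bij[of "UNIV :: 'd set" S] finS card by auto
  have fS: "f i \<in> S" for i using f by (auto simp: bij_betw_def)
  have "orthonormal_family f"
    using f orth[OF fS fS] by (auto simp: orthonormal_family_def bij_betw_def inj_eq)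
  moreover have "\<forall>i. \<exists>l. A *v f i = l *s f i" using S fS unfolding P_def by blast
  ultimately show ?thesis by metis
qed

section \<open>The characteristic polynomial in an eigenbasis\<close>

lemma poly_char_polynomial:
  "poly (char_polynomial A) z = det (mat z - A)"
proof -
  have "poly ((if i = j then [:0, 1:] else 0) - [:A $ i $ j:]) z = (mat z - A) $ i $ j" for i j
    by (simp add: mat_def)
  then show ?thesis by (simp add: char_polynomial_def det_def poly_sum poly_prod)
qed

text \<open>The matrix \<open>P\<close> with columns \<open>f j\<close> diagonalizes
  \<open>A\<close>: \<open>(z - A) P = P D\<close> for every number \<open>z\<close>. Cancelling
  \<open>det P\<close> shows that both polynomials have the same values everywhere.\<close>

lemma char_polynomial_eigenbasis:
  fixes A :: "complex^'d^'d" and f :: "'d \<Rightarrow> complex^'d"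
  assumes f: "orthonormal_family f" and A: "\<And>i. A *v f i = l i *s f i"
  shows "char_polynomial A = (\<Prod>i\<in>UNIV. [:- l i, 1:])"
proof -
  define P where "P = (\<chi> i j. f j $ i)"
  define Q where "Q = (\<chi> j i. cnj (f j $ i))"
  \<comment> \<open>\<open>Q\<close> is the conjugate transpose of \<open>P\<close>, so this is the
    orthonormality of the columns; it makes \<open>det P\<close> nonzero.\<close>
  have "Q ** P = mat 1"
    using f by (simp add: P_def Q_def matrix_matrix_mult_def vec_eq_iff mat_def
        orthonormal_family_def cinner_def mult.commute)
  then have "det Q * det P = 1" by (metis det_mul det_I)
  then have P0: "det P \<noteq> 0" by auto
  have "poly (char_polynomial A) z = poly (\<Prod>i\<in>UNIV. [:- l i, 1:]) z" for z
  proof -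
    define D where "D = (\<chi> i j. if i = j then z - l i else 0)"
    have Af: "(\<Sum>k\<in>UNIV. A $ i $ k * f j $ k) = l j * f j $ i" for i j
      using A[of j] by (simp add: vec_eq_iff matrix_vector_mult_def)
    have "(\<Sum>k\<in>UNIV. mat z $ i $ k * f j $ k) = z * f j $ i" for i j
      by (simp add: mat_def if_distrib if_distribR cong: if_cong)
    moreover have "(P ** D) $ i $ j = f j $ i * (z - l j)" for i j
      by (simp add: matrix_matrix_mult_def P_def D_def if_distrib if_distribR cong: if_cong)
    moreover have "((mat z - A) ** P) $ i $ j
        = (\<Sum>k\<in>UNIV. mat z $ i $ k * f j $ k) - (\<Sum>k\<in>UNIV. A $ i $ k * f j $ k)" for i j
      by (simp add: matrix_matrix_mult_def P_def left_diff_distrib sum_subtractf)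
    ultimately have "(mat z - A) ** P = P ** D"
      by (simp add: vec_eq_iff Af right_diff_distrib mult.commute[of "l _"] mult.commute[of z])
    then have "det (mat z - A) * det P = det P * det D" by (metis det_mul)
    then have "det (mat z - A) = det D" using P0 by (simp add: mult.commute)
    also have "\<dots> = (\<Prod>i\<in>UNIV. D $ i $ i)" by (rule det_diagonal) (simp add: D_def)
    finally show ?thesis by (simp add: poly_char_polynomial poly_prod D_def)
  qed
  then show ?thesis by (simp add: poly_eq_poly_eq_iff[symmetric] fun_eq_iff)
qed

lemma proots_char_polynomial_eigenbasis:
  fixes A :: "complex^'d^'d" and f :: "'d \<Rightarrow> complex^'d"
  assumes "orthonormal_family f" and "\<And>i. A *v f i = l i *s f i"
  shows "proots (char_polynomial A) = image_mset l (mset_set UNIV)"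
proof -
  have "proots (\<Prod>i\<in>UNIV. [:- l i, 1:]) = (\<Sum>i\<in>UNIV. {#l i#})"
    by (subst proots_prod) auto
  also have "\<dots> = image_mset l (mset_set UNIV)"
    by (simp add: sum_unfold_sum_mset image_mset.compositionality)
  finally show ?thesis by (simp add: char_polynomial_eigenbasis[OF assms])
qed

section \<open>Quadratic forms on spans of eigenvectors\<close>

lemma cinner_orthonormal_sums:
  assumes f: "orthonormal_family f" and I: "finite I"
  shows "cinner (\<Sum>i\<in>I. a i *s f i) (\<Sum>i\<in>I. b i *s f i) = (\<Sum>i\<in>I. a i * cnj (b i))"
proof -
  have "cinner (\<Sum>i\<in>I. a i *s f i) (\<Sum>i\<in>I. b i *s f i)
      = (\<Sum>j\<in>I. \<Sum>i\<in>I. if i = j then a i * cnj (b i) else 0)"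
    unfolding cinner_sum_left cinner_sum_right cinner_scale_left cinner_scale_right sum_distrib_left
    using f by (intro sum.cong refl) (auto simp: orthonormal_family_def)
  then show ?thesis using I by simp
qed

lemma orthonormal_family_inj: "orthonormal_family f \<Longrightarrow> inj f"
  unfolding orthonormal_family_def inj_def by (metis zero_neq_one)

lemma dim_span_orthonormal:
  assumes f: "orthonormal_family f"
  shows "vec.dim (vec.span (f ` I)) = card I"
proof -
  have "vec.independent (f ` I)"
    using f orthonormal_family_inj[OF f]
    by (intro orthonormal_set_independent) (auto simp: orthonormal_family_def inj_eq)
  then show ?thesis
    using vec.dim_span_eq_card_independent card_image[OF inj_on_subset[OF orthonormal_family_inj[OF f] subset_UNIV]]
    by metis
qed

text \<open>In the coordinates \<open>c\<close> of \<open>v\<close> along the eigenvectors, the form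
  becomes a weighted sum of the numbers \<open>Re (\<theta> * l i)\<close> with total weight
  \<open>(norm v)\<^sup>2\<close>. The same weights serve every \<theta>.\<close>

lemma quadratic_form_eigenspan:
  fixes A :: "complex^'d^'d" and f :: "'d \<Rightarrow> complex^'d"
  assumes f: "orthonormal_family f" and A: "\<And>i. A *v f i = l i *s f i" and v: "v \<in> vec.span (f ` I)"
  obtains c where "(norm v)\<^sup>2 = (\<Sum>i\<in>I. (cmod (c i))\<^sup>2)"
    "\<And>\<theta>. Re (\<theta> * cinner (A *v v) v) = (\<Sum>i\<in>I. Re (\<theta> * l i) * (cmod (c i))\<^sup>2)"
proof -
  have I: "finite I" by simp
  have inj: "inj_on f I" using orthonormal_family_inj[OF f] inj_on_subset by blast
  obtain u where "v = (\<Sum>x\<in>f ` I. u x *s x)"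
    using v by (subst (asm) vec.span_finite) auto
  then have v: "v = (\<Sum>i\<in>I. u (f i) *s f i)" by (simp add: sum.reindex[OF inj])
  have Av: "A *v v = (\<Sum>i\<in>I. (u (f i) * l i) *s f i)"
    by (simp add: v vec.sum vec.scale A vector_smult_assoc)
  have "complex_of_real ((norm v)\<^sup>2) = cinner v v" by (simp add: cinner_self)
  also have "\<dots> = of_real (\<Sum>i\<in>I. (cmod (u (f i)))\<^sup>2)"
    by (simp add: v cinner_orthonormal_sums[OF f I] complex_norm_square del: of_real_power)
  finally have 1: "(norm v)\<^sup>2 = (\<Sum>i\<in>I. (cmod (u (f i)))\<^sup>2)"
    using of_real_eq_iff by blast
  have "cinner (A *v v) v = (\<Sum>i\<in>I. l i * of_real ((cmod (u (f i)))\<^sup>2))"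
    unfolding Av by (subst v) (simp add: cinner_orthonormal_sums[OF f I] complex_norm_square mult_ac del: of_real_power)
  then have "Re (\<theta> * cinner (A *v v) v) = (\<Sum>i\<in>I. Re (\<theta> * l i) * (cmod (u (f i)))\<^sup>2)" for \<theta>
    by (simp add: sum_distrib_left algebra_simps del: of_real_power)
  from that[OF 1 this] show ?thesis .
qed

text \<open>Cauchy-Schwarz in every row.\<close>

lemma norm_matrix_vector_le_frobenius:
  fixes A :: "complex^'d^'d"
  shows "norm (A *v x) \<le> norm A * norm x"
proof -
  have "cmod ((A *v x) $ i) \<le> norm (A $ i) * norm x" for i
  proof -
    have "cmod ((A *v x) $ i) \<le> (\<Sum>j\<in>UNIV. \<bar>cmod (A $ i $ j)\<bar> * \<bar>cmod (x $ j)\<bar>)"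
      unfolding matrix_vector_mult_def by (auto intro!: order_trans[OF norm_sum] simp: norm_mult)
    also have "\<dots> \<le> norm (A $ i) * norm x"
      unfolding norm_vec_def by (rule L2_set_mult_ineq)
    finally show ?thesis .
  qed
  then have "norm (A *v x) \<le> L2_set (\<lambda>i. norm (A $ i) * norm x) UNIV"
    unfolding norm_vec_def[of "A *v x"] by (intro L2_set_mono) auto
  also have "\<dots> = norm A * norm x"
    by (simp add: norm_vec_def[of A] L2_set_left_distrib)
  finally show ?thesis .
qed

section \<open>Weyl's inequality and Almgren embeddings of spectra\<close>

text \<open>If the conclusion failed, the spans of the two groups of eigenvectors
  would meet in a nonzero vector by counting dimensions.\<close>
lemma weyl_count:
  fixes A B :: "complex^'d^'d" and f g :: "'d \<Rightarrow> complex^'d"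
  assumes f: "orthonormal_family f" "\<And>i. A *v f i = a i *s f i"
    and g: "orthonormal_family g" "\<And>i. B *v g i = b i *s g i"
    and \<theta>: "cmod \<theta> = 1" and s: "t + norm (A - B) \<le> s"
  shows "card {i. Re (\<theta> * a i) \<le> t} + card {i. s < Re (\<theta> * b i)} \<le> CARD('d)"
proof (rule ccontr)
  let ?I = "{i. Re (\<theta> * a i) \<le> t}" and ?J = "{i. s < Re (\<theta> * b i)}"
  let ?V = "vec.span (f ` ?I)" and ?W = "vec.span (g ` ?J)"
  assume "\<not> ?thesis"
  moreover have "vec.dim {x + y |x y. x \<in> ?V \<and> y \<in> ?W} \<le> CARD('d)"
    by (rule vec_dim_le_card)
  moreover have "vec.dim {x + y |x y. x \<in> ?V \<and> y \<in> ?W} + vec.dim (?V \<inter> ?W) = card ?I + card ?J"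
    unfolding vec.dim_sums_Int[OF vec.subspace_span vec.subspace_span]
      dim_span_orthonormal[OF f(1)] dim_span_orthonormal[OF g(1)] ..
  ultimately have "vec.dim (?V \<inter> ?W) \<noteq> 0" by linarith
  then have "\<not> ?V \<inter> ?W \<subseteq> {0}" by (simp add: vec.dim_eq_0)
  then obtain v where v: "v \<in> ?V" "v \<in> ?W" "v \<noteq> 0" by blast
  obtain c where c: "(norm v)\<^sup>2 = (\<Sum>i\<in>?I. (cmod (c i))\<^sup>2)"
    "\<And>\<theta>. Re (\<theta> * cinner (A *v v) v) = (\<Sum>i\<in>?I. Re (\<theta> * a i) * (cmod (c i))\<^sup>2)"
    using quadratic_form_eigenspan[OF f v(1)] by blast
  obtain e where e: "(norm v)\<^sup>2 = (\<Sum>i\<in>?J. (cmod (e i))\<^sup>2)"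
    "\<And>\<theta>. Re (\<theta> * cinner (B *v v) v) = (\<Sum>i\<in>?J. Re (\<theta> * b i) * (cmod (e i))\<^sup>2)"
    using quadratic_form_eigenspan[OF g v(2)] by blast
  \<comment> \<open>On the common vector \<open>v\<close> the form of \<open>A\<close> is at most
    \<open>t\<close>, and that of \<open>B\<close> exceeds \<open>s\<close>, times the squared norm.
    This gap is larger than the norm of \<open>A - B\<close> permits.\<close>
  have 1: "Re (\<theta> * cinner (A *v v) v) \<le> t * (norm v)\<^sup>2"
    unfolding c sum_distrib_left by (intro sum_mono mult_right_mono) auto
  \<comment> \<open>A positive weight is what makes the next inequality strict.\<close>
  have "(\<Sum>i\<in>?J. (cmod (e i))\<^sup>2) > 0" using v(3) unfolding e(1)[symmetric] by simp
  then obtain j where j: "j \<in> ?J" "e j \<noteq> 0"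
    by (metis (no_types, lifting) norm_zero power_zero_numeral less_irrefl sum.neutral)
  have 2: "Re (\<theta> * cinner (B *v v) v) > s * (norm v)\<^sup>2"
    unfolding e sum_distrib_left
    by (rule sum_strict_mono_ex1) (use j in \<open>auto intro!: mult_right_mono bexI[of _ j]\<close>)
  have "Re (\<theta> * cinner (B *v v) v) - Re (\<theta> * cinner (A *v v) v) = (\<theta> *s ((B - A) *v v)) \<bullet> v"
    by (simp add: matrix_vector_mult_diff_rdistrib cinner_diff_left cinner_scale_left algebra_simps
        flip: Re_cinner)
  also have "\<dots> \<le> norm (\<theta> *s ((B - A) *v v)) * norm v" by (rule norm_cauchy_schwarz)
  also have "norm (\<theta> *s ((B - A) *v v)) = norm ((B - A) *v v)"
    by (simp add: norm_vec_def norm_mult \<theta>)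
  also have "norm ((B - A) *v v) * norm v \<le> norm (B - A) * norm v * norm v"
    by (intro mult_right_mono norm_matrix_vector_le_frobenius) auto
  also have "\<dots> = norm (A - B) * (norm v)\<^sup>2" by (simp add: norm_minus_commute power2_eq_square)
  finally have "s * (norm v)\<^sup>2 < (t + norm (A - B)) * (norm v)\<^sup>2"
    using 1 2 by (simp add: algebra_simps)
  also have "\<dots> \<le> s * (norm v)\<^sup>2" using s by (intro mult_right_mono) auto
  finally show False by simp
qed

text \<open>Otherwise, with \<open>t = xs ! k\<close>, the first \<open>k + 1\<close> entries of
  \<open>xs\<close> are at most \<open>t\<close> and the last \<open>n - k\<close> entries of
  \<open>ys\<close> exceed \<open>t + \<delta>\<close>, which makes \<open>n + 1\<close> in
  all.\<close>

lemma sorted_nth_le_of_counts: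
  fixes xs ys :: "real list"
  assumes "sorted xs" "sorted ys" and len: "length xs = n" "length ys = n" and k: "k < n"
    and count: "\<And>t. length (filter (\<lambda>x. x \<le> t) xs) + length (filter (\<lambda>y. t + \<delta> < y) ys) \<le> n"
  shows "ys ! k \<le> xs ! k + \<delta>"
proof (rule ccontr)
  assume less: "\<not> ?thesis"
  let ?P = "\<lambda>x. x \<le> xs ! k" and ?Q = "\<lambda>y. xs ! k + \<delta> < y"
  have "filter ?P (take (Suc k) xs) = take (Suc k) xs"
    using assms by (auto simp: filter_id_conv in_set_conv_nth intro!: sorted_nth_mono)
  then have 1: "length (filter ?P xs) \<ge> Suc k"
    using k len by (subst append_take_drop_id[of "Suc k" xs, symmetric], subst filter_append) simp
  have "ys ! k \<le> y" if y: "y \<in> set (drop k ys)" for y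
  proof -
    obtain i where "k + i < n" "y = ys ! (k + i)"
      using y len k by (force simp: in_set_conv_nth)
    then show ?thesis using assms by (auto intro!: sorted_nth_mono)
  qed
  then have "filter ?Q (drop k ys) = drop k ys"
    using less by (fastforce simp: filter_id_conv)
  then have 2: "length (filter ?Q ys) \<ge> n - k"
    using k len by (subst append_take_drop_id[of k ys, symmetric], subst filter_append) simp
  show False using count[of "xs ! k"] 1 2 k by linarith
qed

lemma length_filter_sorted_values:
  "length (filter P (sorted_values \<theta> (image_mset l (mset_set (UNIV :: 'd::finite set)))))
    = card {i. P (real_form \<theta> (l i))}"
proof -
  have "length (filter P (sorted_values \<theta> (image_mset l (mset_set (UNIV :: 'd set)))))
    = size (filter_mset P (image_mset (\<lambda>i. real_form \<theta> (l i)) (mset_set (UNIV :: 'd set))))"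
    by (simp add: sorted_values_def image_mset.compositionality o_def flip: size_mset)
  also have "\<dots> = card {i. P (real_form \<theta> (l i))}"
    by (simp add: filter_mset_image_mset filter_mset_mset_set)
  finally show ?thesis .
qed

lemma sorted_eigenvalues_nth_le:
  fixes A B :: "complex^'d^'d" and f g :: "'d \<Rightarrow> complex^'d"
  assumes "orthonormal_family f" "\<And>i. A *v f i = a i *s f i"
    and "orthonormal_family g" "\<And>i. B *v g i = b i *s g i"
    and "cmod \<theta> = 1" and "k < CARD('d)"
  shows "sorted_values \<theta> (proots (char_polynomial B)) ! k
    \<le> sorted_values \<theta> (proots (char_polynomial A)) ! k + norm (A - B)"
  unfolding proots_char_polynomial_eigenbasis[OF assms(1,2)]
    proots_char_polynomial_eigenbasis[OF assms(3,4)]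
proof (rule sorted_nth_le_of_counts[OF _ _ _ _ assms(6)])
  fix t
  show "length (filter (\<lambda>x. x \<le> t) (sorted_values \<theta> (image_mset a (mset_set UNIV))))
    + length (filter (\<lambda>y. t + norm (A - B) < y) (sorted_values \<theta> (image_mset b (mset_set UNIV))))
    \<le> CARD('d)"
    unfolding length_filter_sorted_values real_form_def
    using weyl_count[OF assms(1-5)] by blast
qed (simp_all add: sorted_values_def flip: size_mset)

section \<open>Embedded spectra as Lipschitz functions of the matrix\<close>

lemma size_proots_char_polynomial:
  fixes A :: "complex^'d^'d"
  assumes "A \<in> normal_matrices"
  shows "size (proots (char_polynomial A)) = CARD('d)"
proof -
  obtain f :: "'d \<Rightarrow> complex^'d" and l where f: "orthonormal_family f" "\<And>i. A *v f i = l i *s f i"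
    using normal_matrix_eigenbasis[OF assms] by blast
  show ?thesis by (simp add: proots_char_polynomial_eigenbasis[OF f])
qed

lemma length_sorted_values: "length (sorted_values \<theta> M) = size M"
  by (simp add: sorted_values_def flip: size_mset)

text \<open>Weyl's inequality is applied in both directions. The form with \<open>list_all2\<close>
  passes through \<open>concat\<close>, which joins the blocks of the embedding.\<close>

lemma sorted_eigenvalues_close:
  fixes A B :: "complex^'d^'d"
  assumes A: "A \<in> normal_matrices" and B: "B \<in> normal_matrices" and \<theta>: "cmod \<theta> = 1"
  shows "list_all2 (\<lambda>x y. \<bar>x - y\<bar> \<le> norm (A - B))
    (sorted_values \<theta> (proots (char_polynomial A))) (sorted_values \<theta> (proots (char_polynomial B)))"
proof -
  obtain f :: "'d \<Rightarrow> complex^'d" and a where f: "orthonormal_family f" "\<And>i. A *v f i = a i *s f i"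
    using normal_matrix_eigenbasis[OF A] by blast
  obtain g :: "'d \<Rightarrow> complex^'d" and b where g: "orthonormal_family g" "\<And>i. B *v g i = b i *s g i"
    using normal_matrix_eigenbasis[OF B] by blast
  have "\<bar>sorted_values \<theta> (proots (char_polynomial A)) ! k
      - sorted_values \<theta> (proots (char_polynomial B)) ! k\<bar> \<le> norm (A - B)" if "k < CARD('d)" for k
    using sorted_eigenvalues_nth_le[OF f g \<theta> that] sorted_eigenvalues_nth_le[OF g f \<theta> that]
    by (simp add: norm_minus_commute)
  then show ?thesis
    by (simp add: list_all2_conv_all_nth length_sorted_values size_proots_char_polynomial A B)
qed

lemma list_all2_concat_map:
  assumes "\<And>x. x \<in> set xs \<Longrightarrow> list_all2 R (f x) (g x)"
  shows "list_all2 R (concat (map f xs)) (concat (map g xs))"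
  using assms by (induction xs) (auto intro: list_all2_appendI)

lemma almgren_map_close:
  fixes A B :: "complex^'d^'d"
  assumes A: "A \<in> normal_matrices" and B: "B \<in> normal_matrices" and \<theta>s: "\<forall>\<theta>\<in>set \<theta>s. cmod \<theta> = 1"
  shows "\<bar>almgren_map \<theta>s (proots (char_polynomial A)) j
    - almgren_map \<theta>s (proots (char_polynomial B)) j\<bar> \<le> norm (A - B)"
proof -
  let ?c = "\<lambda>A :: complex^'d^'d. concat (map (\<lambda>\<theta>. sorted_values \<theta> (proots (char_polynomial A))) \<theta>s)"
  have all2: "list_all2 (\<lambda>x y. \<bar>x - y\<bar> \<le> norm (A - B)) (?c A) (?c B)"
    using \<theta>s by (intro list_all2_concat_map sorted_eigenvalues_close A B) auto
  show ?thesis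
  proof (cases "j < length (?c A)")
    case True
    \<comment> \<open>A position inside the list forces at least one form, so dividing by the square
      root of their number does not enlarge differences.\<close>
    then have "\<theta>s \<noteq> []" by auto
    then have h: "sqrt (real (length \<theta>s)) \<ge> 1" by (cases \<theta>s) auto
    have j: "j < length (?c B)" using True list_all2_lengthD[OF all2] by simp
    have "\<bar>?c A ! j / sqrt (real (length \<theta>s)) - ?c B ! j / sqrt (real (length \<theta>s))\<bar>
        = \<bar>?c A ! j - ?c B ! j\<bar> / sqrt (real (length \<theta>s))"
      by (simp add: abs_divide flip: diff_divide_distrib)
    also have "\<dots> \<le> \<bar>?c A ! j - ?c B ! j\<bar>"
      using h by (simp add: divide_le_eq mult_le_cancel_left1)
    also have "\<dots> \<le> norm (A - B)" by (rule list_all2_nthD[OF all2 True])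
    finally show ?thesis using True j by (simp add: almgren_map_def nth_default_nth)
  next
    case False
    \<comment> \<open>The two lists have equal length, so past the end both coordinates are the
      default 0.\<close>
    then show ?thesis
      using list_all2_lengthD[OF all2] by (simp add: almgren_map_def nth_default_beyond)
  qed
qed

definition spectral_map :: "(complex multiset \<Rightarrow> nat \<Rightarrow> real) \<Rightarrow> complex^'d^'d \<Rightarrow> nat \<Rightarrow> real" where
  "spectral_map \<Delta> A = \<Delta> (proots (char_polynomial A))"

text \<open>The Hoelder norm estimates below use spectra only through this coordinatewise
  bound.\<close>

lemma spectral_map_close:
  fixes A B :: "complex^'d^'d"
  assumes "almgren_embedding CARD('d) N \<Delta>" and A: "A \<in> normal_matrices" and B: "B \<in> normal_matrices"
  shows "\<bar>spectral_map \<Delta> A j - spectral_map \<Delta> B j\<bar> \<le> norm (A - B)"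
  using assms almgren_map_close[OF A B]
  by (auto simp: almgren_embedding_def almgren_forms_def unordered_tuples_def spectral_map_def
      size_proots_char_polynomial)

lemma euclidean_norm_le:
  assumes "\<And>j. \<bar>v j\<bar> \<le> c"
  shows "euclidean_norm N v \<le> real N * c"
proof -
  have "euclidean_norm N v \<le> (\<Sum>j<N. \<bar>v j\<bar>)"
    unfolding euclidean_norm_def by (rule L2_set_le_sum_abs)
  also have "\<dots> \<le> real N * c" using sum_bounded_above[of "{..<N}" "\<lambda>j. \<bar>v j\<bar>" c] assms by simp
  finally show ?thesis .
qed

lemma euclidean_norm_diff_le: "euclidean_norm N (u - v) \<le> euclidean_norm N u + euclidean_norm N v"
proof -
  have eq: "u - v = (\<lambda>i. u i + - v i)" by (simp add: fun_eq_iff)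
  have "euclidean_norm N (u - v) \<le> L2_set u {..<N} + L2_set (\<lambda>i. - v i) {..<N}"
    unfolding euclidean_norm_def eq by (rule L2_set_triangle_ineq)
  also have "L2_set (\<lambda>i. - v i) {..<N} = L2_set v {..<N}" by (simp add: L2_set_def)
  finally show ?thesis unfolding euclidean_norm_def .
qed

section \<open>Hoelder norms\<close>

lemma holder_norm_le:
  assumes "\<And>x. x \<in> U \<Longrightarrow> nrm (f x) \<le> a"
    and "\<And>x y. x \<in> U \<Longrightarrow> y \<in> U \<Longrightarrow> x \<noteq> y \<Longrightarrow> nrm (f x - f y) \<le> b * norm (x - y) powr \<alpha>"
  shows "holder_norm nrm U \<alpha> f \<le> ennreal a + ennreal b"
  unfolding holder_norm_def
proof (intro add_mono SUP_least, goal_cases)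
  case (1 x)
  then show ?case using assms(1) by (simp add: ennreal_leI)
next
  case (2 p)
  then obtain x y where "p = (x, y)" "x \<in> U" "y \<in> U" "x \<noteq> y" by auto
  then show ?case using assms(2)[of x y] by (auto intro!: ennreal_leI simp: divide_le_eq)
qed

lemma holder_norm_leD:
  assumes r: "holder_norm nrm U \<alpha> f \<le> ennreal r" "0 \<le> r" and x: "x \<in> U"
  shows "nrm (f x) \<le> r"
proof -
  have "ennreal (nrm (f x)) \<le> (SUP x\<in>U. ennreal (nrm (f x)))" using x by (rule SUP_upper)
  also have "\<dots> \<le> holder_norm nrm U \<alpha> f" by (simp add: holder_norm_def)
  finally show ?thesis using r by (meson ennreal_le_iff order_trans)
qed

lemma holder_seminorm_leD:
  assumes r: "holder_norm nrm U \<alpha> f \<le> ennreal r" "0 \<le> r" and "x \<in> U" "y \<in> U" "x \<noteq> y"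
  shows "nrm (f x - f y) \<le> r * norm (x - y) powr \<alpha>"
proof -
  have "ennreal (nrm (f x - f y) / norm (x - y) powr \<alpha>) \<le>
     (SUP (x, y)\<in>{(x, y). x \<in> U \<and> y \<in> U \<and> x \<noteq> y}.
        ennreal (nrm (f x - f y) / norm (x - y) powr \<alpha>))"
    using assms(3-) by (intro SUP_upper2[of "(x, y)"]) auto
  also have "\<dots> \<le> holder_norm nrm U \<alpha> f" by (simp add: holder_norm_def)
  finally have "nrm (f x - f y) / norm (x - y) powr \<alpha> \<le> r"
    using r by (meson ennreal_le_iff order_trans)
  then show ?thesis using \<open>x \<noteq> y\<close> by (simp add: divide_le_eq)
qed

text \<open>Split \<open>q\<close> into its powers with exponents \<open>1 - \<alpha>\<close> and
  \<alpha>, and bound the first by \<open>a\<close>, the second by \<open>b * s\<close>. With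
  \<open>a\<close> a uniform bound and \<open>b\<close> a Lipschitz constant, the Hoelder constant
  becomes small with \<open>a\<close> as long as \<open>b\<close> stays bounded.\<close>

lemma powr_interpolation:
  fixes q a b s \<alpha> :: real
  assumes "0 \<le> q" "q \<le> a" "q \<le> b * s" "0 \<le> b" "0 \<le> s" "0 < \<alpha>" "\<alpha> < 1"
  shows "q \<le> a powr (1 - \<alpha>) * b powr \<alpha> * s powr \<alpha>"
proof -
  have "q = q powr (1 - \<alpha>) * q powr \<alpha>"
    using assms(1) by (cases "q = 0") (simp_all flip: powr_add)
  also have "\<dots> \<le> a powr (1 - \<alpha>) * (b * s) powr \<alpha>"
    using assms by (intro mult_mono powr_mono2) auto
  also have "\<dots> = a powr (1 - \<alpha>) * b powr \<alpha> * s powr \<alpha>"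
    using assms by (simp add: powr_mult)
  finally show ?thesis .
qed

lemma lipschitz_normal_bounds:
  assumes "A \<in> lipschitz_normal U"
  shows "\<exists>L\<ge>0. (\<forall>x\<in>U. norm (A x) \<le> L) \<and> (\<forall>x\<in>U. \<forall>y\<in>U. norm (A x - A y) \<le> L * norm (x - y))"
proof -
  have "holder_norm norm U 1 A < \<infinity>" using assms by (simp add: lipschitz_normal_def holder_space_def)
  then obtain L where L: "0 \<le> L" "holder_norm norm U 1 A \<le> ennreal L"
    by (cases "holder_norm norm U 1 A") auto
  have "norm (A x - A y) \<le> L * norm (x - y)" if "x \<in> U" "y \<in> U" for x y
    using holder_seminorm_leD[OF L(2,1) that] by (cases "x = y") auto
  with L(1) holder_norm_leD[OF L(2,1)] show ?thesis by blast
qed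

lemma lipschitz_on_continuous_extension:
  fixes f :: "'a::metric_space \<Rightarrow> 'b::complete_space"
  assumes "L-lipschitz_on U f"
  shows "\<exists>g. continuous_on (closure U) g \<and> (\<forall>x\<in>U. g x = f x)"
proof (rule uniformly_continuous_on_extension_on_closure[OF lipschitz_on_uniformly_continuous[OF assms]])
  fix g assume "uniformly_continuous_on (closure U) g" "\<And>x. x \<in> U \<Longrightarrow> f x = g x"
  then show ?thesis by (intro exI[of _ g]) (simp add: uniformly_continuous_imp_continuous)
qed

section \<open>Hoelder regularity and convergence for exponents below 1\<close>

lemma unordered_eigenvalues_holder:
  fixes A :: "real^'m \<Rightarrow> complex^'d^'d"
  assumes A: "A \<in> lipschitz_normal U" and \<alpha>: "0 < \<alpha>" "\<alpha> < 1"
  shows "unordered_eigenvalues A \<in> holder_unordered CARD('d) U \<alpha>"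
proof -
  have normal: "A x \<in> normal_matrices" if "x \<in> U" for x
    using A that by (simp add: lipschitz_normal_def)
  obtain L where L0: "0 \<le> L" and bd: "\<forall>x\<in>U. norm (A x) \<le> L"
    and lip: "\<forall>x\<in>U. \<forall>y\<in>U. norm (A x - A y) \<le> L * norm (x - y)"
    using lipschitz_normal_bounds[OF A] by blast
  note L = L0 bd[rule_format] lip[rule_format]
  have "\<Delta> \<circ> unordered_eigenvalues A \<in> holder_space (euclidean_norm N) U \<alpha>"
    if \<Delta>: "almgren_embedding CARD('d) N \<Delta>" for N \<Delta>
  proof -
    let ?f = "\<lambda>x. spectral_map \<Delta> (A x)"
    have f: "\<Delta> \<circ> unordered_eigenvalues A = ?f"
      by (auto simp: unordered_eigenvalues_def spectral_map_def)
    have close: "\<bar>?f x j - ?f y j\<bar> \<le> norm (A x - A y)" if "x \<in> U" "y \<in> U" for x y j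
      using spectral_map_close[OF \<Delta> normal normal] that by blast
    \<comment> \<open>The extension to the closure is built one coordinate at a time, because
      continuity into the product topology is coordinatewise.\<close>
    have ex: "\<exists>g. continuous_on (closure U) g \<and> (\<forall>x\<in>U. g x = ?f x j)" for j
    proof -
      have "L-lipschitz_on U (\<lambda>x. ?f x j)"
      proof (rule lipschitz_onI[OF _ L(1)])
        fix x y assume x: "x \<in> U" and y: "y \<in> U"
        show "dist (?f x j) (?f y j) \<le> L * dist x y"
          using close[OF x y, of j] L(3)[OF x y] by (simp add: dist_norm)
      qed
      then show ?thesis by (rule lipschitz_on_continuous_extension)
    qed
    define g where "g j = (SOME g. continuous_on (closure U) g \<and> (\<forall>x\<in>U. g x = ?f x j))" for j
    have g: "continuous_on (closure U) (g j)" "x \<in> U \<Longrightarrow> g j x = ?f x j" for j x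
      using someI_ex[OF ex, of j] unfolding g_def by blast+
    have "continuous_on (closure U) (\<lambda>x j. g j x)"
      by (rule continuous_on_coordinatewise_then_product) (rule g)
    moreover have "\<forall>x\<in>U. (\<lambda>j. g j x) = ?f x" using g by auto
    ultimately have ext: "\<exists>g. continuous_on (closure U) g \<and> (\<forall>x\<in>U. g x = ?f x)" by blast
    \<comment> \<open>The embedded spectrum of the zero matrix is a fixed reference point; all
      values of \<open>?f\<close> on \<open>U\<close> lie within \<open>real N * L\<close> of
      it.\<close>
    let ?z = "spectral_map \<Delta> (0 :: complex^'d^'d)"
    have zero: "(0 :: complex^'d^'d) \<in> normal_matrices" by (simp add: normal_matrices_def)
    have b1: "euclidean_norm N (?f x) \<le> euclidean_norm N ?z + real N * L" if x: "x \<in> U" for x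
    proof -
      have "?f x = ?z - (?z - ?f x)" by (auto simp: fun_diff_def)
      then have "euclidean_norm N (?f x) \<le> euclidean_norm N ?z + euclidean_norm N (?z - ?f x)"
        using euclidean_norm_diff_le[of N ?z "?z - ?f x"] by simp
      moreover have "euclidean_norm N (?z - ?f x) \<le> real N * L"
      proof (rule euclidean_norm_le)
        show "\<bar>(?z - ?f x) j\<bar> \<le> L" for j
          using spectral_map_close[OF \<Delta> zero normal[OF x], of j] L(2)[OF x] by (simp add: fun_diff_def)
      qed
      ultimately show ?thesis by simp
    qed
    have b2: "euclidean_norm N (?f x - ?f y)
        \<le> ((real N * (2 * L)) powr (1 - \<alpha>) * (real N * L) powr \<alpha>) * norm (x - y) powr \<alpha>"
      if x: "x \<in> U" and y: "y \<in> U" for x y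
    proof -
      have 1: "euclidean_norm N (?f x - ?f y) \<le> real N * norm (A x - A y)"
        using close[OF x y] by (intro euclidean_norm_le) (simp add: fun_diff_def)
      have "norm (A x - A y) \<le> 2 * L"
        using L(2)[OF x] L(2)[OF y] norm_triangle_ineq4[of "A x" "A y"] by linarith
      then have 2: "euclidean_norm N (?f x - ?f y) \<le> real N * (2 * L)"
        using 1 by (meson mult_left_mono of_nat_0_le_iff order_trans)
      have 3: "euclidean_norm N (?f x - ?f y) \<le> real N * L * norm (x - y)"
        using 1 mult_left_mono[OF L(3)[OF x y], of "real N"] by (simp add: mult.assoc)
      show ?thesis
        by (rule powr_interpolation[OF _ 2 3]) (use \<alpha> L in \<open>auto simp: euclidean_norm_def\<close>)
    qed
    have "holder_norm (euclidean_norm N) U \<alpha> ?f \<le> ennreal (euclidean_norm N ?z + real N * L)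
        + ennreal ((real N * (2 * L)) powr (1 - \<alpha>) * (real N * L) powr \<alpha>)"
      by (rule holder_norm_le) (simp_all only: b1 b2)
    also have "\<dots> < \<infinity>" by simp
    finally show ?thesis using ext unfolding f holder_space_def by blast
  qed
  then show ?thesis
    using normal by (auto simp: holder_unordered_def unordered_tuples_def unordered_eigenvalues_def
        size_proots_char_polynomial)
qed

text \<open>The four spectra in a difference quotient can be paired in two ways. Pairing
  \<open>A\<close> with \<open>B\<close> at each point gives a small uniform bound; pairing the two
  points for each map gives a Lipschitz bound. The two are then interpolated.\<close>

lemma holder_norm_spectral_diff_le:
  fixes A B :: "real^'m \<Rightarrow> complex^'d^'d"
  assumes \<Delta>: "almgren_embedding CARD('d) N \<Delta>"
    and normal: "\<And>x. x \<in> U \<Longrightarrow> A x \<in> normal_matrices" "\<And>x. x \<in> U \<Longrightarrow> B x \<in> normal_matrices"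
    and L: "0 \<le> L" "\<And>x y. x \<in> U \<Longrightarrow> y \<in> U \<Longrightarrow> norm (A x - A y) \<le> L * norm (x - y)"
    and r: "0 \<le> r" "holder_norm norm U 1 (\<lambda>x. A x - B x) \<le> ennreal r"
    and \<alpha>: "0 < \<alpha>" "\<alpha> < 1"
  shows "holder_norm (euclidean_norm N) U \<alpha> (\<lambda>x. spectral_map \<Delta> (A x) - spectral_map \<Delta> (B x))
    \<le> ennreal (real N * r) + ennreal ((real N * (2 * r)) powr (1 - \<alpha>) * (real N * (2 * L + r)) powr \<alpha>)"
proof (rule holder_norm_le)
  have AB: "norm (A x - B x) \<le> r" if "x \<in> U" for x
    using holder_norm_leD[OF r(2,1) that] .
  show "euclidean_norm N (spectral_map \<Delta> (A x) - spectral_map \<Delta> (B x)) \<le> real N * r" if x: "x \<in> U" for x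
  proof (rule euclidean_norm_le)
    show "\<bar>(spectral_map \<Delta> (A x) - spectral_map \<Delta> (B x)) j\<bar> \<le> r" for j
      using spectral_map_close[OF \<Delta> normal(1)[OF x] normal(2)[OF x], of j] AB[OF x]
      by (simp add: fun_diff_def)
  qed
  fix x y assume x: "x \<in> U" and y: "y \<in> U" and xy: "x \<noteq> y"
  let ?g = "\<lambda>x. spectral_map \<Delta> (A x) - spectral_map \<Delta> (B x)"
  have "\<bar>(?g x - ?g y) j\<bar> \<le> norm (A x - B x) + norm (A y - B y)" for j
    using spectral_map_close[OF \<Delta> normal(1)[OF x] normal(2)[OF x], of j]
      spectral_map_close[OF \<Delta> normal(1)[OF y] normal(2)[OF y], of j] by (simp add: fun_diff_def)
  moreover have "norm (A x - B x) + norm (A y - B y) \<le> 2 * r"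
    using AB[OF x] AB[OF y] by simp
  ultimately have 2: "euclidean_norm N (?g x - ?g y) \<le> real N * (2 * r)"
    by (intro euclidean_norm_le) (meson order_trans)
  \<comment> \<open>\<open>B\<close> inherits the Lipschitz constant \<open>L + r\<close>, so along
    a convergent sequence a constant for the limit controls all late members.\<close>
  have "norm (B x - B y) \<le> norm (A x - A y) + norm ((A x - B x) - (A y - B y))"
    using norm_triangle_ineq4[of "A x - A y" "(A x - B x) - (A y - B y)"] by (simp add: algebra_simps)
  also have "norm ((A x - B x) - (A y - B y)) \<le> r * norm (x - y)"
    using holder_seminorm_leD[OF r(2,1) x y xy] by simp
  finally have "norm (A x - A y) + norm (B x - B y) \<le> (2 * L + r) * norm (x - y)"
    using L(2)[OF x y] by (simp add: algebra_simps)
  moreover have "\<bar>(?g x - ?g y) j\<bar> \<le> norm (A x - A y) + norm (B x - B y)" for j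
    using spectral_map_close[OF \<Delta> normal(1)[OF x] normal(1)[OF y], of j]
      spectral_map_close[OF \<Delta> normal(2)[OF x] normal(2)[OF y], of j] by (simp add: fun_diff_def)
  ultimately have "euclidean_norm N (?g x - ?g y) \<le> real N * ((2 * L + r) * norm (x - y))"
    by (intro euclidean_norm_le) (meson order_trans)
  then have 3: "euclidean_norm N (?g x - ?g y) \<le> real N * (2 * L + r) * norm (x - y)"
    by (simp add: mult.assoc)
  show "euclidean_norm N (?g x - ?g y)
    \<le> (real N * (2 * r)) powr (1 - \<alpha>) * (real N * (2 * L + r)) powr \<alpha> * norm (x - y) powr \<alpha>"
    by (rule powr_interpolation[OF _ 2 3]) (use \<alpha> L r in \<open>auto simp: euclidean_norm_def\<close>)
qed

lemma tendsto_holder_norm_spectral_diff: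
  fixes A :: "real^'m \<Rightarrow> complex^'d^'d"
  assumes conv: "tendsto_lipschitz_normal U An A" and \<Delta>: "almgren_embedding CARD('d) N \<Delta>"
    and \<alpha>: "0 < \<alpha>" "\<alpha> < 1"
  shows "(\<lambda>n. holder_norm (euclidean_norm N) U \<alpha>
    (\<lambda>x. spectral_map \<Delta> (A x) - spectral_map \<Delta> (An n x))) \<longlonglongrightarrow> 0"
proof -
  let ?e = "\<lambda>n. holder_norm norm U 1 (\<lambda>x. A x - An n x)"
  define r where "r n = enn2real (?e n)" for n
  have A: "A \<in> lipschitz_normal U" and e0: "?e \<longlonglongrightarrow> 0"
    using conv by (auto simp: tendsto_lipschitz_normal_def)
  have An: "An n \<in> lipschitz_normal U" for n
    using conv by (auto simp: tendsto_lipschitz_normal_def)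
  obtain L where L: "0 \<le> L" and lip: "\<forall>x\<in>U. \<forall>y\<in>U. norm (A x - A y) \<le> L * norm (x - y)"
    using lipschitz_normal_bounds[OF A] by blast
  have r0: "r \<longlonglongrightarrow> 0"
    unfolding r_def using tendsto_enn2real[of ?e 0 sequentially] e0 by simp
  let ?b = "\<lambda>n. ennreal (real N * r n) +
    ennreal ((real N * (2 * r n)) powr (1 - \<alpha>) * (real N * (2 * L + r n)) powr \<alpha>)"
  \<comment> \<open>\<open>enn2real\<close> sends infinity to 0, so \<open>r n\<close> represents
    the norm faithfully only where the norm is finite; below 1 it is.\<close>
  have "\<forall>\<^sub>F n in sequentially. ?e n < 1" using e0 by (rule order_tendstoD) simp
  then have "\<forall>\<^sub>F n in sequentially. holder_norm (euclidean_norm N) U \<alpha>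
    (\<lambda>x. spectral_map \<Delta> (A x) - spectral_map \<Delta> (An n x)) \<le> ?b n"
  proof eventually_elim
    case (elim n)
    then have "?e n < top" using less_trans[OF _ ennreal_one_less_top] by blast
    then have "?e n \<le> ennreal (r n)" by (simp add: r_def)
    moreover have "0 \<le> r n" by (simp add: r_def)
    ultimately show ?case
      using A An by (intro holder_norm_spectral_diff_le[OF \<Delta>] L lip[rule_format] \<alpha>) (auto simp: lipschitz_normal_def)
  qed
  moreover have "?b \<longlonglongrightarrow> ennreal (real N * 0) +
      ennreal (0 * (real N * (2 * L + 0)) powr \<alpha>)"
  proof (intro tendsto_add tendsto_ennrealI tendsto_mult tendsto_const r0)
    \<comment> \<open>This is where \<alpha> below 1 enters: the exponent
      \<open>1 - \<alpha>\<close> is positive, so this factor vanishes in the limit while the other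
      one converges.\<close>
    show "(\<lambda>n. (real N * (2 * r n)) powr (1 - \<alpha>)) \<longlonglongrightarrow> 0"
    proof (rule tendsto_zero_powrI[where b = "1 - \<alpha>"])
      show "(\<lambda>n. real N * (2 * r n)) \<longlonglongrightarrow> 0"
        using tendsto_mult_left[OF tendsto_mult_left[OF r0, of 2], of "real N"] by simp
    qed (use \<alpha> in \<open>auto simp: r_def\<close>)
    show "(\<lambda>n. (real N * (2 * L + r n)) powr \<alpha>) \<longlonglongrightarrow> (real N * (2 * L + 0)) powr \<alpha>"
    proof (rule tendsto_powr2)
      show "(\<lambda>n. real N * (2 * L + r n)) \<longlonglongrightarrow> real N * (2 * L + 0)"
        by (intro tendsto_intros r0)
    qed (use \<alpha> L in \<open>auto simp: r_def\<close>)
  qed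
  ultimately show ?thesis
    using tendsto_sandwich[of "\<lambda>_. 0" _ sequentially ?b 0] by simp
qed

section \<open>Failure for the exponent 1\<close>

text \<open>Among \<open>d\<^sup>2 + 1\<close> pairwise non-parallel forms, each nonzero number is nearly annihilated
  by at most one of them, so some form nearly annihilates none of the \<open>d\<^sup>2\<close> numbers.  The form
  \<open>\<theta> = 1\<close> comes first, so that coordinate 0 of the embedding is the smallest real part.\<close>
lemma ex_almgren_forms: "\<exists>\<theta>s. almgren_forms d (1 # \<theta>s)"
proof -
  define n where "n = Suc (d\<^sup>2)"
  \<comment> \<open>Equally spaced directions in a half circle starting at 1, hence no two of them
    parallel.\<close>
  define \<theta> where "\<theta> k = cis (pi * real k / real n)" for k
  have n0: "real n > 0" unfolding n_def by (rule of_nat_0_less_iff[THEN iffD2]) simp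
  have Im: "Im (\<theta> k * cnj (\<theta> l)) \<noteq> 0" if kl: "k < n" "l < n" "k \<noteq> l" for k l
  proof -
    let ?a = "pi * (real k - real l) / real n"
    have eq: "\<theta> k * cnj (\<theta> l) = cis ?a"
      by (simp add: \<theta>_def cis_cnj cis_mult diff_divide_distrib right_diff_distrib)
    have "\<bar>real k - real l\<bar> < real n" using kl by linarith
    then have "\<bar>(real k - real l) / real n\<bar> < 1" using n0 by (simp add: abs_divide)
    then have "\<bar>?a\<bar> < pi" by (simp add: abs_mult flip: times_divide_eq_right)
    moreover have "?a \<noteq> 0" using kl n0 by simp
    ultimately have "sin ?a \<noteq> 0" by (metis sin_zero_pi_iff)
    then show ?thesis unfolding eq by simp
  qed
  have inj: "inj_on \<theta> {..<n}"
  proof (rule inj_onI, rule ccontr)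
    fix k l assume "k \<in> {..<n}" "l \<in> {..<n}" "\<theta> k = \<theta> l" "k \<noteq> l"
    then show False using Im[of k l] by (simp add: complex_mult_cnj)
  qed
  \<comment> \<open>Inserting 1 keeps the set nonempty when \<open>n = 1\<close>. The divisor 3
    below matches the final estimate, a sum of three quantities each less than
    \<open>c * cmod w\<close>.\<close>
  let ?D = "insert 1 ((\<lambda>(k, l). \<bar>Im (\<theta> k * cnj (\<theta> l))\<bar>) ` {(k, l). k < n \<and> l < n \<and> k \<noteq> l})"
  define c where "c = Min ?D / 3"
  have "{(k, l). k < n \<and> l < n \<and> k \<noteq> l} \<subseteq> {..<n} \<times> {..<n}" by auto
  then have finD: "finite ?D" using finite_subset by blast
  have c0: "0 < c" using Im finD by (auto simp: c_def)
  have c_le: "3 * c \<le> \<bar>Im (\<theta> k * cnj (\<theta> l))\<bar>" if "k < n" "l < n" "k \<noteq> l" for k l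
  proof -
    have "Min ?D \<le> \<bar>Im (\<theta> k * cnj (\<theta> l))\<bar>" using that by (intro Min_le[OF finD]) auto
    then show ?thesis by (simp add: c_def)
  qed
  let ?ts = "map \<theta> [0..<n]"
  have "\<exists>t\<in>set ?ts. \<forall>k<d\<^sup>2. \<bar>real_form t (z k)\<bar> \<ge> c * cmod (z k)" for z :: "nat \<Rightarrow> complex"
  proof (rule ccontr)
    assume "\<not> ?thesis"
    then have "\<forall>j<n. \<exists>k<d\<^sup>2. \<bar>Re (\<theta> j * z k)\<bar> < c * cmod (z k)"
      by (fastforce simp: real_form_def not_le)
    then obtain \<kappa> where \<kappa>: "\<And>j. j < n \<Longrightarrow> \<kappa> j < d\<^sup>2 \<and> \<bar>Re (\<theta> j * z (\<kappa> j))\<bar> < c * cmod (z (\<kappa> j))"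
      by metis
    have "\<not> inj_on \<kappa> {..<n}"
    proof
      assume "inj_on \<kappa> {..<n}"
      then have "card {..<n} \<le> card {..<d\<^sup>2}" using \<kappa> by (intro card_inj_on_le) auto
      then show False by (simp add: n_def)
    qed
    then obtain i j where ij: "i < n" "j < n" "i \<noteq> j" "\<kappa> i = \<kappa> j" by (auto simp: inj_on_def)
    define w where "w = z (\<kappa> i)"
    have 1: "\<bar>Re (\<theta> i * w)\<bar> < c * cmod w" "\<bar>Re (\<theta> j * w)\<bar> < c * cmod w"
      using \<kappa>[OF ij(1)] \<kappa>[OF ij(2)] ij(4) by (simp_all add: w_def)
    \<comment> \<open>The rotation \<open>u\<close> carries form \<open>i\<close> to form
      \<open>j\<close>, so both values are real parts, of \<open>v\<close> and of
      \<open>u * v\<close>. If both are small, so is the imaginary part of \<open>v\<close>, as that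
      of \<open>u\<close> is bounded below; then \<open>w\<close> itself would be too short.\<close>
    define u where "u = \<theta> j * cnj (\<theta> i)"
    define v where "v = \<theta> i * w"
    have u1: "cmod u = 1" by (simp add: u_def \<theta>_def norm_mult)
    have v1: "cmod v = cmod w" by (simp add: v_def \<theta>_def norm_mult)
    have "cnj (\<theta> i) * \<theta> i = 1" by (simp add: \<theta>_def cis_cnj cis_mult)
    then have uv: "u * v = \<theta> j * w" by (simp add: u_def v_def mult.assoc mult.left_commute[of "\<theta> i"])
    have "\<bar>Im u\<bar> * \<bar>Im v\<bar> \<le> \<bar>Re (u * v)\<bar> + \<bar>Re u\<bar> * \<bar>Re v\<bar>"
      by (simp flip: abs_mult)
    also have "\<bar>Re u\<bar> * \<bar>Re v\<bar> \<le> 1 * \<bar>Re v\<bar>"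
      using abs_Re_le_cmod[of u] u1 by (intro mult_right_mono) auto
    finally have 2: "\<bar>Im u\<bar> * \<bar>Im v\<bar> \<le> \<bar>Re (u * v)\<bar> + \<bar>Re v\<bar>" by simp
    have 3: "\<bar>Im u\<bar> * \<bar>Re v\<bar> \<le> 1 * \<bar>Re v\<bar>"
      using abs_Im_le_cmod[of u] u1 by (intro mult_right_mono) auto
    have "3 * c * cmod w \<le> \<bar>Im u\<bar> * cmod w"
      using c_le[of j i] ij by (intro mult_right_mono) (auto simp: u_def)
    also have "\<dots> \<le> \<bar>Im u\<bar> * (\<bar>Re v\<bar> + \<bar>Im v\<bar>)"
      using cmod_le[of v] v1 by (intro mult_left_mono) auto
    also have "\<dots> \<le> \<bar>Re (u * v)\<bar> + 2 * \<bar>Re v\<bar>"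
      using 2 3 by (simp add: distrib_left)
    also have "\<dots> < 3 * c * cmod w"
      using 1 unfolding uv by (simp add: v_def)
    finally show False by simp
  qed
  then have "almgren_forms d ?ts"
    using c0 inj by (auto simp: almgren_forms_def distinct_map \<theta>_def lessThan_atLeast0)
  moreover have "?ts = 1 # map \<theta> [1..<n]"
    by (simp add: n_def upt_rec[of 0] \<theta>_def del: upt_Suc)
  ultimately show ?thesis by metis
qed

section \<open>Diagonal matrices with at most one nonzero entry\<close>

definition corner_matrix :: "'d \<Rightarrow> complex \<Rightarrow> complex^'d^'d" where
  "corner_matrix k s = axis k (axis k s)"

lemma corner_matrix_nth: "corner_matrix k s $ i $ j = (if i = k \<and> j = k then s else 0)"
  by (simp add: corner_matrix_def axis_def)

lemma norm_axis: "norm (axis k x :: 'a::real_normed_vector^'d) = norm x"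
proof -
  have "norm (axis k x :: 'a^'d) = sqrt (\<Sum>i\<in>UNIV. if i = k then (norm x)\<^sup>2 else 0)"
    unfolding norm_vec_def L2_set_def axis_def
    by (intro arg_cong[of _ _ sqrt] sum.cong) auto
  then show ?thesis by simp
qed

lemma norm_corner_matrix: "norm (corner_matrix k s) = cmod s"
  by (simp add: corner_matrix_def norm_axis)

lemma corner_matrix_diff: "corner_matrix k s - corner_matrix k t = corner_matrix k (s - t)"
  by (simp add: vec_eq_iff corner_matrix_nth)

lemma corner_matrix_mult: "corner_matrix k s ** corner_matrix k t = corner_matrix k (s * t)"
proof -
  have "(corner_matrix k s ** corner_matrix k t) $ i $ j
      = (\<Sum>l\<in>UNIV. if l = k then if i = k \<and> j = k then s * t else 0 else 0)" for i j
    unfolding matrix_matrix_mult_def vec_lambda_beta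
    by (intro sum.cong) (auto simp: corner_matrix_nth)
  then show ?thesis by (simp add: vec_eq_iff corner_matrix_nth)
qed

lemma corner_matrix_normal: "corner_matrix k s \<in> normal_matrices"
proof -
  have "adjoint_matrix (corner_matrix k s) = corner_matrix k (cnj s)"
    by (simp add: vec_eq_iff adjoint_matrix_def map_matrix_def transpose_def corner_matrix_nth)
  then show ?thesis by (simp add: normal_matrices_def corner_matrix_mult mult.commute)
qed

lemma proots_corner_matrix:
  "proots (char_polynomial (corner_matrix k s)) = image_mset (\<lambda>i. if i = k then s else 0) (mset_set UNIV)"
proof (rule proots_char_polynomial_eigenbasis)
  have "cinner (axis i 1) (axis j 1 :: complex^'a) = (\<Sum>a\<in>UNIV. if a = i then if a = j then 1 else 0 else 0)"
    for i j
    unfolding cinner_def by (intro sum.cong) (auto simp: axis_def)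
  then show "orthonormal_family (\<lambda>i. axis i 1 :: complex^'a)"
    by (simp add: orthonormal_family_def)
  fix i
  have "(corner_matrix k s *v axis i 1) $ a = (\<Sum>b\<in>UNIV. if b = i then if a = k \<and> b = k then s else 0 else 0)"
    for a
    unfolding matrix_vector_mult_def vec_lambda_beta
    by (intro sum.cong) (auto simp: axis_def corner_matrix_nth)
  then show "corner_matrix k s *v axis i 1 = (if i = k then s else 0) *s axis i 1"
    by (auto simp: vec_eq_iff axis_def)
qed

text \<open>Coordinate 0 is the head of the block of the form 1, that is, the smallest real part in
  the spectrum. A second index, present by \<open>d\<close>, supplies the eigenvalue 0 beside
  \<open>s\<close>.\<close>

lemma spectral_map_corner_matrix:
  fixes k :: "'d::finite"
  assumes d: "CARD('d) \<ge> 2"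
  shows "spectral_map (almgren_map (1 # \<theta>s)) (corner_matrix k (of_real s)) 0
    = min s 0 / sqrt (real (length (1 # \<theta>s)))"
proof -
  let ?M = "proots (char_polynomial (corner_matrix k (of_real s)))"
  let ?xs = "sorted_values 1 ?M"
  obtain j :: 'd where j: "j \<noteq> k"
  proof -
    have "UNIV \<noteq> {k}"
    proof
      assume "UNIV = {k}"
      then have "CARD('d) = card {k}" by (rule arg_cong)
      then show False using d by simp
    qed
    then show ?thesis using that by blast
  qed
  have "set_mset ?M = range (\<lambda>i. if i = k then of_real s else 0)"
    unfolding proots_corner_matrix set_image_mset finite_set_mset_mset_set[OF finite] ..
  also have "\<dots> = {of_real s, 0}" using j by auto
  finally have "set_mset ?M = {of_real s, 0}" .
  then have set: "set ?xs = {s, 0}" by (simp add: sorted_values_def real_form_def)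
  then obtain y ys where ys: "?xs = y # ys" by (cases ?xs) auto
  have "sorted ?xs" by (simp add: sorted_values_def)
  then have "\<forall>z\<in>set ?xs. y \<le> z" unfolding ys by simp
  moreover have "y \<in> set ?xs" unfolding ys by simp
  ultimately have "y \<le> s" "y \<le> 0" "y \<in> {s, 0}" unfolding set by simp_all
  then have "y = min s 0" by auto
  then show ?thesis by (simp add: spectral_map_def almgren_map_def ys)
qed

lemma corner_matrix_lipschitz_normal:
  fixes U :: "(real^'m) set"
  assumes U: "bounded U" and e: "norm e = 1"
  shows "(\<lambda>x. corner_matrix k (of_real ((x - p) \<bullet> e + t))) \<in> lipschitz_normal U"
proof -
  let ?A = "\<lambda>x. corner_matrix k (complex_of_real ((x - p) \<bullet> e + t))"
  obtain D where D: "\<And>x. x \<in> U \<Longrightarrow> norm x \<le> D" using U by (auto simp: bounded_iff)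
  have lip: "norm (?A x - ?A y) \<le> 1 * norm (x - y)" for x y
  proof -
    have "norm (?A x - ?A y) = \<bar>(x - y) \<bullet> e\<bar>"
      by (simp add: corner_matrix_diff norm_corner_matrix inner_diff_left flip: of_real_diff)
    also have "\<dots> \<le> norm (x - y)" using Cauchy_Schwarz_ineq2[of "x - y" e] e by simp
    finally show ?thesis by simp
  qed
  then have "1-lipschitz_on (closure U) ?A" by (intro lipschitz_onI) (auto simp: dist_norm)
  then have "continuous_on (closure U) ?A" by (rule lipschitz_on_continuous_on)
  moreover have "holder_norm norm U 1 ?A \<le> ennreal (D + norm p + \<bar>t\<bar>) + ennreal 1"
  proof (rule holder_norm_le)
    fix x assume x: "x \<in> U"
    have "\<bar>(x - p) \<bullet> e\<bar> \<le> norm (x - p)" using Cauchy_Schwarz_ineq2[of "x - p" e] e by simp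
    then show "norm (?A x) \<le> D + norm p + \<bar>t\<bar>"
      using D[OF x] norm_triangle_ineq4[of x p] unfolding norm_corner_matrix norm_of_real by linarith
  next
    fix x y assume "x \<in> U" "y \<in> U" "x \<noteq> y"
    show "norm (?A x - ?A y) \<le> 1 * norm (x - y) powr 1" using lip by simp
  qed
  then have "holder_norm norm U 1 ?A < \<infinity>" by (simp add: le_less_trans)
  ultimately show ?thesis
    by (auto simp: lipschitz_normal_def holder_space_def corner_matrix_normal)
qed

section \<open>The counterexample\<close>

lemma lipschitz_counterexample:
  fixes U :: "(real^'m) set"
  assumes U: "bounded U" "open U" "U \<noteq> {}" and d: "CARD('d) \<ge> 2"
  shows "\<exists>(An :: nat \<Rightarrow> real^'m \<Rightarrow> complex^'d^'d) A. tendsto_lipschitz_normal U An A \<and>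
    (\<exists>N \<Delta>. almgren_embedding CARD('d) N \<Delta> \<and>
      \<not> (\<lambda>n. holder_norm (euclidean_norm N) U 1
        (\<lambda>x. spectral_map \<Delta> (A x) - spectral_map \<Delta> (An n x))) \<longlonglongrightarrow> 0)"
proof -
  obtain p \<epsilon> where \<epsilon>: "0 < \<epsilon>" "ball p \<epsilon> \<subseteq> U" and p: "p \<in> U"
    using U by (meson all_not_in_conv open_contains_ball)
  define e :: "real^'m" where "e = axis undefined 1"
  have e: "norm e = 1" by (simp add: e_def norm_axis)
  define k :: 'd where "k = undefined"
  define S where "S t x = corner_matrix k (of_real ((x - p) \<bullet> e + t))" for t x
  define t where "t n = 1 / real (Suc n)" for n
  have t: "0 < t n" for n by (simp add: t_def)
  have t0: "t \<longlonglongrightarrow> 0" unfolding t_def using LIMSEQ_inverse_real_of_nat by (simp add: inverse_eq_divide)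
  have SL: "S t \<in> lipschitz_normal U" for t
    unfolding S_def by (rule corner_matrix_lipschitz_normal[OF U(1) e])
  have diff: "S 0 x - S (t n) x = corner_matrix k (of_real (- t n))" for x n
    unfolding S_def corner_matrix_diff of_real_diff[symmetric] by simp
  \<comment> \<open>The difference does not depend on \<open>x\<close>, so its Lipschitz seminorm is
    0 and only its size \<open>t n\<close> counts.\<close>
  have "holder_norm norm U 1 (\<lambda>x. S 0 x - S (t n) x) \<le> ennreal (t n) + ennreal 0" for n
    unfolding diff
    by (rule holder_norm_le) (simp_all add: norm_corner_matrix less_imp_le[OF t])
  moreover have "(\<lambda>n. ennreal (t n) + ennreal 0) \<longlonglongrightarrow> 0"
    using tendsto_ennrealI[OF t0] by simp
  ultimately have "(\<lambda>n. holder_norm norm U 1 (\<lambda>x. S 0 x - S (t n) x)) \<longlonglongrightarrow> 0"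
    using tendsto_sandwich[of "\<lambda>_. 0" _ sequentially "\<lambda>n. ennreal (t n) + ennreal 0" 0] by simp
  then have conv: "tendsto_lipschitz_normal U (\<lambda>n. S (t n)) (S 0)"
    using SL by (simp add: tendsto_lipschitz_normal_def)
  obtain \<theta>s where \<theta>s: "almgren_forms CARD('d) (1 # \<theta>s)" using ex_almgren_forms by blast
  define h where "h = sqrt (real (length (1 # \<theta>s)))"
  have h: "h > 0" by (simp add: h_def)
  define N where "N = CARD('d) * length (1 # \<theta>s)"
  have N: "0 < N" by (simp add: N_def)
  let ?\<Delta> = "almgren_map (1 # \<theta>s)"
  have emb: "almgren_embedding CARD('d) N ?\<Delta>"
    using \<theta>s by (auto simp: almgren_embedding_def N_def)
  let ?g = "\<lambda>n x. spectral_map ?\<Delta> (S 0 x) - spectral_map ?\<Delta> (S (t n) x)"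
  have "\<not> (\<lambda>n. holder_norm (euclidean_norm N) U 1 (?g n)) \<longlonglongrightarrow> 0"
  proof
    assume "(\<lambda>n. holder_norm (euclidean_norm N) U 1 (?g n)) \<longlonglongrightarrow> 0"
    \<comment> \<open>The threshold is half of \<open>1 / h\<close>, the slope of coordinate 0
      between \<open>p\<close> and the point \<open>y\<close> below.\<close>
    then have "\<forall>\<^sub>F n in sequentially. holder_norm (euclidean_norm N) U 1 (?g n) < ennreal (1 / (2 * h))"
      by (rule order_tendstoD) (use h in simp)
    moreover have "\<forall>\<^sub>F n in sequentially. t n < \<epsilon>" using t0 \<epsilon>(1) by (rule order_tendstoD)
    ultimately have "\<forall>\<^sub>F n in sequentially. t n < \<epsilon> \<and>
      holder_norm (euclidean_norm N) U 1 (?g n) < ennreal (1 / (2 * h))" by eventually_elim simp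
    then obtain n where n: "t n < \<epsilon>"
      "holder_norm (euclidean_norm N) U 1 (?g n) \<le> ennreal (1 / (2 * h))"
      using eventually_happens'[OF sequentially_bot] by (metis (lifting) less_imp_le)
    \<comment> \<open>From \<open>y\<close>, where the affine function is \<open>- t n\<close>, to
      \<open>p\<close>, where it is 0, one minimum rises by \<open>t n\<close> and the other stays
      0. The choice \<open>t n < \<epsilon>\<close> keeps \<open>y\<close> in
      \<open>U\<close>.\<close>
    define y where "y = p - t n *\<^sub>R e"
    have py: "norm (p - y) = t n" using t[of n] e by (simp add: y_def)
    have y: "y \<in> U" using \<epsilon>(2) n(1) py by (auto simp: dist_norm)
    have ye: "(y - p) \<bullet> e = - t n" using e by (simp add: y_def norm_eq_1)
    have g: "?g n x 0 = (min ((x - p) \<bullet> e) 0 - min ((x - p) \<bullet> e + t n) 0) / h" for x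
      unfolding S_def fun_diff_def spectral_map_corner_matrix[OF d] h_def by (simp add: diff_divide_distrib)
    have "(?g n p - ?g n y) 0 = t n / h"
      using t[of n] unfolding fun_diff_def[of "?g n p" "?g n y"] g ye by (simp add: min_def)
    moreover have "(?g n p - ?g n y) 0 \<le> euclidean_norm N (?g n p - ?g n y)"
      unfolding euclidean_norm_def using N by (intro member_le_L2_set) auto
    moreover have "euclidean_norm N (?g n p - ?g n y) \<le> 1 / (2 * h) * norm (p - y) powr 1"
      using t[of n] py h by (intro holder_seminorm_leD[OF n(2) _ p y]) auto
    ultimately have "t n / h \<le> 1 / (2 * h) * t n" using t[of n] by (simp add: py)
    then show False using t[of n] h by (simp add: field_simps)
  qed
  with emb have "\<exists>N \<Delta>. almgren_embedding CARD('d) N \<Delta> \<and>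
      \<not> (\<lambda>n. holder_norm (euclidean_norm N) U 1
        (\<lambda>x. spectral_map \<Delta> (S 0 x) - spectral_map \<Delta> (S (t n) x))) \<longlonglongrightarrow> 0"
    by (intro exI conjI)
  with conv show ?thesis
    by (intro exI[of _ "\<lambda>n. S (t n)"] exI[of _ "S 0"] conjI)
qed

text \<open>The failure is claimed for nonempty \<open>U\<close> and at least two eigenvalues: over
  the empty set every norm is 0, and for \<open>d = 1\<close> the single eigenvalue is linear in the
  matrix, so convergence persists at exponent 1.\<close>

theorem corollary1p12:
  fixes U :: "(real^'m) set"
  assumes "bounded U" and "lipschitz_domain U"
  shows
    "(\<forall>(An :: nat \<Rightarrow> real^'m \<Rightarrow> complex^'d^'d) A. tendsto_lipschitz_normal U An A \<longrightarrow>
        (\<forall>\<alpha>. 0 < \<alpha> \<and> \<alpha> < 1 \<longrightarrow>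
           unordered_eigenvalues A \<in> holder_unordered CARD('d) U \<alpha> \<and>
           (\<forall>n. unordered_eigenvalues (An n) \<in> holder_unordered CARD('d) U \<alpha>) \<and>
           (\<forall>N \<Delta>. almgren_embedding CARD('d) N \<Delta> \<longrightarrow>
              (\<lambda>n. holder_norm (euclidean_norm N) U \<alpha>
                 (\<lambda>x. \<Delta> (unordered_eigenvalues A x) - \<Delta> (unordered_eigenvalues (An n) x)))
                 \<longlonglongrightarrow> 0)))
     \<and>
     (U \<noteq> {} \<and> CARD('d) \<ge> 2 \<longrightarrow>
        (\<exists>(An :: nat \<Rightarrow> real^'m \<Rightarrow> complex^'d^'d) A. tendsto_lipschitz_normal U An A \<and>
           \<not> (\<forall>N \<Delta>. almgren_embedding CARD('d) N \<Delta> \<longrightarrow>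
              (\<lambda>n. holder_norm (euclidean_norm N) U 1
                 (\<lambda>x. \<Delta> (unordered_eigenvalues A x) - \<Delta> (unordered_eigenvalues (An n) x)))
                 \<longlonglongrightarrow> 0)))"
proof (intro conjI allI impI)
  fix An :: "nat \<Rightarrow> real^'m \<Rightarrow> complex^'d^'d" and A and \<alpha> :: real
  assume conv: "tendsto_lipschitz_normal U An A" and \<alpha>: "0 < \<alpha> \<and> \<alpha> < 1"
  have A: "A \<in> lipschitz_normal U" and An: "\<And>n. An n \<in> lipschitz_normal U"
    using conv by (simp_all add: tendsto_lipschitz_normal_def)
  show "unordered_eigenvalues A \<in> holder_unordered CARD('d) U \<alpha>"
    using unordered_eigenvalues_holder[OF A] \<alpha> by blast
  show "unordered_eigenvalues (An n) \<in> holder_unordered CARD('d) U \<alpha>" for n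
    using unordered_eigenvalues_holder[OF An] \<alpha> by blast
  fix N \<Delta> assume "almgren_embedding CARD('d) N \<Delta>"
  from tendsto_holder_norm_spectral_diff[OF conv this] \<alpha>
  show "(\<lambda>n. holder_norm (euclidean_norm N) U \<alpha>
      (\<lambda>x. \<Delta> (unordered_eigenvalues A x) - \<Delta> (unordered_eigenvalues (An n) x))) \<longlonglongrightarrow> 0"
    by (simp add: unordered_eigenvalues_def spectral_map_def)
next
  assume "U \<noteq> {} \<and> CARD('d) \<ge> 2"
  then have U: "U \<noteq> {}" and d: "CARD('d) \<ge> 2" by auto
  have "open U" using assms(2) by (simp add: lipschitz_domain_def)
  from lipschitz_counterexample[OF assms(1) this U d]
  obtain An :: "nat \<Rightarrow> real^'m \<Rightarrow> complex^'d^'d" and A N \<Delta>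
    where "tendsto_lipschitz_normal U An A" and \<Delta>: "almgren_embedding CARD('d) N \<Delta>"
      "\<not> (\<lambda>n. holder_norm (euclidean_norm N) U 1
        (\<lambda>x. spectral_map \<Delta> (A x) - spectral_map \<Delta> (An n x))) \<longlonglongrightarrow> 0"
    by (elim exE conjE)
  moreover have "\<not> (\<forall>N \<Delta>. almgren_embedding CARD('d) N \<Delta> \<longrightarrow>
        (\<lambda>n. holder_norm (euclidean_norm N) U 1
          (\<lambda>x. \<Delta> (unordered_eigenvalues A x) - \<Delta> (unordered_eigenvalues (An n) x))) \<longlonglongrightarrow> 0)"
    using \<Delta> unfolding unordered_eigenvalues_def spectral_map_def by blast
  ultimately show "\<exists>(An :: nat \<Rightarrow> real^'m \<Rightarrow> complex^'d^'d) A. tendsto_lipschitz_normal U An A \<and>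
      \<not> (\<forall>N \<Delta>. almgren_embedding CARD('d) N \<Delta> \<longrightarrow>
        (\<lambda>n. holder_norm (euclidean_norm N) U 1
          (\<lambda>x. \<Delta> (unordered_eigenvalues A x) - \<Delta> (unordered_eigenvalues (An n) x))) \<longlonglongrightarrow> 0)"
    by (intro exI conjI)
qed

end
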